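(* Assume that the kernel $K:\mathbb{R}^N\setminus\{0\}\to(0,+\infty)$ satisfies $\int_{\mathbb{R}^N}\min\{|x|^2,1\}K(x)\,dx<+\infty$, $K(x)=K(-x)$ for all $x\in\mathbb{R}^N\setminus\{0\}$, and $K(x)\ge K(y)$ whenever $|x|\le|y|$, and that $$s_0=\sup\Big\{s\ge0\ \Big|\ \lim_{r\to0^+}r^{2s}\int_{B_r^c(0)}K(y)\,dy=+\infty\Big\}\in(0,1].$$ Let $2^*(s_0)=\frac{2N}{N-2s_0}$. Then for every $p\in(2,2^*(s_0))$ the problem $$\mathcal{L}_Ku+|u|^{p-2}u=0\ \text{ in }\Omega,\qquad u=0\ \text{ in }\Omega^c,$$ admits a nontrivial weak solution.
   Context: $N\ge2$ and $\Omega\subset\mathbb{R}^N$ is an open bounded $C^2$ domain, $\Omega^c=\mathbb{R}^N\setminus\Omega$, $\mathcal{O}=\Omega^c\times\Omega^c$. $K$ is measurable. $B_r^c(0)$ is the complement in $\mathbb{R}^N$ of the ball of radius $r$ centered at the origin. The operator is $\mathcal{L}_Ku(x)=\frac12\int_{\mathbb{R}^N}[u(x+y)+u(x-y)-2u(x)]K(y)\,dy$. $X$ is the linear space of Lebesgue measurable functions $g:\mathbb{R}^N\to\mathbb{R}$ (identified when equal a.e.) such that $g|_\Omega\in L^2(\Omega)$ and $\int_{\mathbb{R}^{2N}\setminus\mathcal{O}}(g(x)-g(y))^2K(x-y)\,dx\,dy<+\infty$; $X_0=\{g\in X\mid g=0\text{ a.e. in }\Omega^c\}$. A function $u\in X_0$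 is a weak solution of $\mathcal{L}_Ku+f(x,u)=0$ in $\Omega$, $u=0$ in $\Omega^c$, if $$\int_{\mathbb{R}^N\times\mathbb{R}^N}[u(x)-u(y)][\varphi(x)-\varphi(y)]K(x-y)\,dx\,dy=\int_\Omega f(x,u(x))\varphi(x)\,dx\quad\text{for any }\varphi\in X_0;$$ here $f(x,u)=|u|^{p-2}u$. Nontrivial means not a.e. zero. Convention: $2^*(s_0)=+\infty$ when $N=2$ and $s_0=1$. *)

theory Defs
  imports "HOL-Analysis.Analysis"
begin

definition C2_function :: "('a::euclidean_space \<Rightarrow> real) \<Rightarrow> bool" where
  "C2_function f \<longleftrightarrow>
    (\<exists>(g :: 'a \<Rightarrow> 'a) (H :: 'a \<Rightarrow> 'a \<Rightarrow>\<^sub>L 'a).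
      (\<forall>x. (f has_derivative (\<lambda>h. g x \<bullet> h)) (at x)) \<and>
      (\<forall>x. (g has_derivative blinfun_apply (H x)) (at x)) \<and>
      continuous_on UNIV H)"

text \<open>
  Near each boundary point, the set is the strict epigraph of a \<open>C\<^sup>2\<close> function of the
  coordinates orthogonal to some unit vector \<open>\<nu>\<close> (the \<open>N\<close>-th axis after a rotation). Instead of
  using an \<open>(N-1)\<close>-dimensional type, \<open>\<gamma>\<close> is defined on the whole space but only evaluated on the
  hyperplane orthogonal to \<open>\<nu>\<close>; a \<open>C\<^sup>2\<close> function on the hyperplane extends by being constant
  along \<open>\<nu>\<close>.
\<close>

definition C2_boundary :: "'a::euclidean_space set \<Rightarrow> bool" where
  "C2_boundary \<Omega> \<longleftrightarrow>
    (\<forall>x0 \<in> frontier \<Omega>. \<exists>r > 0. \<exists>\<nu> \<gamma>. norm \<nu> = 1 \<and> C2_function \<gamma> \<and>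
      \<Omega> \<inter> ball x0 r = {x \<in> ball x0 r. \<gamma> (x - (x \<bullet> \<nu>) *\<^sub>R \<nu>) < x \<bullet> \<nu>})"

definition bounded_C2_domain :: "'a::euclidean_space set \<Rightarrow> bool" where
  "bounded_C2_domain \<Omega> \<longleftrightarrow>
    open \<Omega> \<and> connected \<Omega> \<and> \<Omega> \<noteq> {} \<and> bounded \<Omega> \<and> C2_boundary \<Omega>"

text \<open>
  Kernels are total functions; their value at \<open>0\<close> is irrelevant, since it only enters integrals
  on null sets (the origin, or the diagonal of the product space). Elements of the function spaces
  are representatives of classes modulo a.e. equality.
\<close>

definition X_space :: "('a::euclidean_space \<Rightarrow> real) \<Rightarrow> 'a set \<Rightarrow> ('a \<Rightarrow> real) set" where
  "X_space K \<Omega> = {g. g \<in> borel_measurable lebesgue \<and>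
      set_integrable lebesgue \<Omega> (\<lambda>x. (g x)\<^sup>2) \<and>
      set_integrable lebesgue (- ((- \<Omega>) \<times> (- \<Omega>)))
        (\<lambda>(x, y). (g x - g y)\<^sup>2 * K (x - y))}"

definition X0_space :: "('a::euclidean_space \<Rightarrow> real) \<Rightarrow> 'a set \<Rightarrow> ('a \<Rightarrow> real) set" where
  "X0_space K \<Omega> = {g \<in> X_space K \<Omega>. AE x in lebesgue. x \<in> - \<Omega> \<longrightarrow> g x = 0}"

text \<open>
  Bochner integrals of non-integrable functions are \<open>0\<close> by convention, so integrability of both
  sides of the weak formulation is demanded explicitly.
\<close>

definition weak_solution ::
    "('a::euclidean_space \<Rightarrow> real) \<Rightarrow> 'a set \<Rightarrow> ('a \<Rightarrow> real \<Rightarrow> real) \<Rightarrow> ('a \<Rightarrow> real) \<Rightarrow> bool" where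
  "weak_solution K \<Omega> f u \<longleftrightarrow> u \<in> X0_space K \<Omega> \<and>
    (\<forall>\<phi> \<in> X0_space K \<Omega>.
      integrable lebesgue (\<lambda>(x, y). (u x - u y) * (\<phi> x - \<phi> y) * K (x - y)) \<and>
      set_integrable lebesgue \<Omega> (\<lambda>x. f x (u x) * \<phi> x) \<and>
      (LINT (x, y)|lebesgue. (u x - u y) * (\<phi> x - \<phi> y) * K (x - y))
        = (LINT x:\<Omega>|lebesgue. f x (u x) * \<phi> x))"

text \<open>
  The supremum is taken in the extended reals, so that it is \<open>-\<infinity>\<close> for the empty set rather than
  an unspecified real number.
\<close>

definition kernel_order :: "('a::euclidean_space \<Rightarrow> real) \<Rightarrow> ereal" where
  "kernel_order K = Sup (ereal ` {s. 0 \<le> s \<and>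
      filterlim (\<lambda>r. r powr (2 * s) * (LINT y:- ball 0 r|lebesgue. K y)) at_top (at_right 0)})"

definition critical_exponent :: "nat \<Rightarrow> real \<Rightarrow> ereal" where
  "critical_exponent N s =
    (if N = 2 \<and> s = 1 then \<infinity> else ereal (2 * real N / (real N - 2 * s)))"

end

theory Submission
  imports Defs "HOL-Library.Diagonal_Subsequence"
begin

text \<open>
  The solution is a multiple of a minimiser of the energy \<open>E u = form u u\<close>, the double integral of
  \<open>(u x - u y)\<^sup>2 * K (x - y)\<close>, among the functions of finite energy that vanish outside \<open>\<Omega>\<close> and satisfy
  \<open>Lp u = 1\<close>, where \<open>Lp u\<close> is the integral of \<open>\<bar>u\<bar> powr p\<close>. The Euler--Lagrange equation of this problem
  (\<open>minimizer_Euler_Lagrange\<close>) is the desired equation up to a positive multiplier, which scaling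
  removes. Write \<open>N\<close> for the dimension. What has to be shown is that the constrained minimum is
  attained, and this rests on two properties of functions of bounded energy. Both use an order
  \<open>s < s0\<close> with \<open>p < q = 2 * N / (N - 2 * s)\<close>, for which the mass \<open>tail r\<close> of the kernel outside the ball
  of radius \<open>r\<close> is at least \<open>c * r powr (- 2 * s)\<close> for bounded \<open>r\<close>.

  First, such functions are bounded in weak \<open>L\<^sup>q\<close> (\<open>weak_type_embedding\<close>). Let \<open>a t\<close> be the measure of
  \<open>{\<bar>u\<bar> > t}\<close>. As \<open>K\<close> decreases radially, the mass of \<open>K (x - _)\<close> outside a set of measure \<open>a t\<close> is
  least for the ball of that measure around \<open>x\<close>; hence
  \<open>E u \<ge> t\<^sup>2 * c' * a t powr (- 2 * s / N) * a (2 * t)\<close>, and iterating this recursion bounds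
  \<open>t powr q * a t\<close>. As \<open>p < q\<close>, the functions \<open>\<bar>u\<bar> powr p\<close> are uniformly integrable
  (\<open>uniform_Lp_tail\<close>).

  Secondly, a sequence of bounded energy and bounded \<open>L\<^sup>1\<close> norm has a subsequence that converges almost
  everywhere (\<open>compact_embedding_L1\<close>). The growth of the tails makes \<open>r ^ N * K\<close> arbitrarily large
  on the balls around the origin of suitable radii \<open>r\<close> (\<open>kernel_concentration\<close>), so on every ball of
  half such a radius a function of bounded energy is close to its mean, and finitely many averages
  determine it up to a small error in \<open>L\<^sup>1\<close>.

  Along a minimising sequence that converges almost everywhere, Fatou's lemma bounds the energy of
  the limit, and uniform integrability shows that \<open>Lp\<close> is at least \<open>1\<close> there; scaling the limit down
  to \<open>Lp u = 1\<close> does not increase the energy. The analysis is carried out for Borel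
  functions vanishing identically outside \<open>\<Omega>\<close>; every element of \<open>X0_space K \<Omega>\<close> agrees almost
  everywhere with one of them.
\<close>

section \<open>Radially decreasing kernels and their tails\<close>

lemma nn_integral_translate:
  fixes f :: "'a::euclidean_space \<Rightarrow> ennreal"
  assumes [measurable]: "f \<in> borel_measurable borel"
  shows "(\<integral>\<^sup>+y. f (y - x) \<partial>lborel) = (\<integral>\<^sup>+y. f y \<partial>lborel)"
proof -
  have "(\<integral>\<^sup>+y. f y \<partial>lborel) = (\<integral>\<^sup>+y. f y \<partial>distr lborel borel ((+) (- x)))"
    by (simp add: lborel_distr_plus)
  also have "\<dots> = (\<integral>\<^sup>+y. f (y - x) \<partial>lborel)"
    by (subst nn_integral_distr) (auto simp: add.commute)
  finally show ?thesis by simp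
qed

text \<open>
  A radially decreasing kernel, positive off the origin and satisfying the Levy integrability
  condition. The value at the origin is normalised to \<open>0\<close>, which makes \<open>K\<close> nonnegative everywhere
  and Borel measurable; it never matters, since the increments that \<open>K\<close> multiplies vanish on the diagonal. Evenness is a
  consequence of \<open>K_decreasing\<close>.
\<close>

locale radial_kernel =
  fixes K :: "'a::euclidean_space \<Rightarrow> real"
  assumes K_borel [measurable]: "K \<in> borel_measurable borel"
    and K_zero: "K 0 = 0"
    and K_pos: "x \<noteq> 0 \<Longrightarrow> 0 < K x"
    and K_decreasing: "x \<noteq> 0 \<Longrightarrow> y \<noteq> 0 \<Longrightarrow> norm x \<le> norm y \<Longrightarrow> K y \<le> K x"
    and K_levy: "integrable lborel (\<lambda>x. min ((norm x)\<^sup>2) 1 * K x)"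
begin

lemma K_nonneg: "0 \<le> K x"
  using K_zero K_pos[of x] by (cases "x = 0") auto

lemma K_radial: "norm x = norm y \<Longrightarrow> K x = K y"
  using K_decreasing[of x y] K_decreasing[of y x] by (cases "x = 0"; cases "y = 0") auto

lemma K_even: "K (x - y) = K (y - x)"
  by (rule K_radial) (rule norm_minus_commute)

text \<open>
  The mass of the kernel outside the ball of radius \<open>r\<close> around the origin; it is finite for \<open>r > 0\<close>.
\<close>

definition tail :: "real \<Rightarrow> real" where
  "tail r = (LINT y:- ball 0 r|lborel. K y)"

lemma K_integrable_outside:
  assumes "0 < r"
  shows "set_integrable lborel (- ball 0 r) K"
  unfolding set_integrable_def
proof (rule Bochner_Integration.integrable_bound)
  show "integrable lborel (\<lambda>x. (1 / min (r\<^sup>2) 1) * (min ((norm x)\<^sup>2) 1 * K x))"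
    using K_levy by simp
  have m: "0 < min (r\<^sup>2) 1" using assms by simp
  have "indicator (- ball 0 r) x * K x \<le> (1 / min (r\<^sup>2) 1) * (min ((norm x)\<^sup>2) 1 * K x)" for x
  proof (cases "x \<in> ball 0 r")
    case False
    then have "r\<^sup>2 \<le> (norm x)\<^sup>2" using assms by (intro power_mono) auto
    then have "min (r\<^sup>2) 1 \<le> min ((norm x)\<^sup>2) 1" by auto
    then have "min (r\<^sup>2) 1 * K x \<le> min ((norm x)\<^sup>2) 1 * K x"
      by (rule mult_right_mono) (rule K_nonneg)
    with m False show ?thesis by (simp add: field_simps)
  qed (use m K_nonneg in auto)
  then show "AE x in lborel. norm (indicator (- ball 0 r) x *\<^sub>R K x)
      \<le> norm ((1 / min (r\<^sup>2) 1) * (min ((norm x)\<^sup>2) 1 * K x))"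
    using m K_nonneg by (auto simp: abs_mult)
qed measurable

lemma tail_nn_integral:
  assumes "0 < r"
  shows "(\<integral>\<^sup>+y\<in>- ball 0 r. ennreal (K y) \<partial>lborel) = ennreal (tail r)"
proof -
  have "ennreal (tail r) = (\<integral>\<^sup>+y. ennreal (indicator (- ball 0 r) y * K y) \<partial>lborel)"
    unfolding tail_def set_lebesgue_integral_def real_scaleR_def
    using K_integrable_outside[OF assms] K_nonneg
    by (intro nn_integral_eq_integral[symmetric]) (auto simp: set_integrable_def)
  also have "\<dots> = (\<integral>\<^sup>+y\<in>- ball 0 r. ennreal (K y) \<partial>lborel)"
    by (intro nn_integral_cong) (auto split: split_indicator)
  finally show ?thesis by simp
qed

lemma tail_nonneg: "0 \<le> tail r"
  unfolding tail_def set_lebesgue_integral_def using K_nonneg by (intro Bochner_Integration.integral_nonneg) auto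

lemma tail_antimono:
  assumes "0 < r" "r \<le> R"
  shows "tail R \<le> tail r"
proof -
  have "ennreal (tail R) \<le> ennreal (tail r)"
    using assms by (subst (1 2) tail_nn_integral[symmetric])
      (auto intro!: nn_integral_mono split: split_indicator)
  then show ?thesis by (simp add: tail_nonneg)
qed

lemma tail_pos:
  assumes "0 < R" shows "0 < tail R"
proof (rule ccontr)
  assume "\<not> 0 < tail R"
  with tail_nonneg[of R] have "tail R = 0" by simp
  then have "(\<integral>\<^sup>+y. ennreal (K y) * indicator (- ball 0 R) y \<partial>lborel) = 0"
    using tail_nn_integral[OF assms] by simp
  then have "AE y in lborel. ennreal (K y) * indicator (- ball 0 R) y = 0"
    by (subst (asm) nn_integral_0_iff_AE) auto
  then have "AE y in lborel. y \<in> ball (0::'a) R"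
  proof eventually_elim
    case (elim y)
    show ?case
    proof (rule ccontr)
      assume "y \<notin> ball 0 R"
      moreover from this have "y \<noteq> 0" using assms by auto
      ultimately show False using elim K_pos[of y] by auto
    qed
  qed
  then have "emeasure lborel (UNIV :: 'a set) \<le> emeasure lborel (ball (0::'a) R)"
    by (intro emeasure_mono_AE) auto
  then show False using emeasure_lborel_ball_finite[of "0::'a" R]
    by (metis emeasure_lborel_UNIV infinity_ennreal_def not_le)
qed

lemma tail_translate:
  assumes "0 < r"
  shows "(\<integral>\<^sup>+y\<in>- ball x r. ennreal (K (x - y)) \<partial>lborel) = ennreal (tail r)"
proof -
  have "(\<integral>\<^sup>+y\<in>- ball x r. ennreal (K (x - y)) \<partial>lborel) =
     (\<integral>\<^sup>+y. ennreal (K (y - x)) * indicator (- ball 0 r) (y - x) \<partial>lborel)"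
    by (intro nn_integral_cong) (auto simp: K_even[of x] dist_norm norm_minus_commute split: split_indicator)
  also have "\<dots> = ennreal (tail r)"
    by (subst nn_integral_translate[where f = "\<lambda>y. ennreal (K y) * indicator (- ball 0 r) y"])
       (auto simp: tail_nn_integral[OF assms])
  finally show ?thesis .
qed

text \<open>
  Among all sets of a given measure, the ball around \<open>x\<close> captures the largest share of the mass of
  \<open>K (x - _)\<close>: the differences of \<open>A\<close> and the ball have equal measure, and the kernel is
  nowhere smaller inside the ball than outside it, except at \<open>x\<close> itself.
\<close>

lemma nn_integral_complement_ge_tail:
  assumes A [measurable]: "A \<in> sets borel" and r: "0 < r"
    and eq: "emeasure lborel A = emeasure lborel (ball x r)"
  shows "ennreal (tail r) \<le> (\<integral>\<^sup>+y\<in>- A. ennreal (K (x - y)) \<partial>lborel)"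
proof -
  let ?B = "ball x r"
  obtain e :: 'a where e: "norm e = 1" using norm_Basis nonempty_Basis by blast
  define k where "k = K (r *\<^sub>R e)"
  have inside: "k \<le> K (x - y)" if "y \<in> ?B" "y \<noteq> x" for y
    unfolding k_def using that r e by (intro K_decreasing) (auto simp: dist_norm)
  have outside: "K (x - y) \<le> k" if "y \<notin> ?B" for y
    unfolding k_def using that r e by (intro K_decreasing) (auto simp: dist_norm)
  have fin: "emeasure lborel A \<noteq> \<infinity>" "emeasure lborel ?B \<noteq> \<infinity>"
    using emeasure_lborel_ball_finite[of x r] eq by auto
  have diff: "emeasure lborel (A - ?B) = emeasure lborel (?B - A)"
  proof -
    have "emeasure lborel (S - T) = emeasure lborel S - emeasure lborel (S \<inter> T)"
      if [measurable]: "S \<in> sets borel" "T \<in> sets borel" and "emeasure lborel S \<noteq> \<infinity>" for S T :: "'a set"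
    proof -
      have "emeasure lborel (S \<inter> T) \<le> emeasure lborel S"
        by (intro emeasure_mono) auto
      then have "emeasure lborel (S \<inter> T) \<noteq> \<infinity>"
        using that(3) by (auto simp: top_unique)
      moreover have "S - T = S - S \<inter> T" by auto
      ultimately show ?thesis
        using emeasure_Diff[of lborel "S \<inter> T" S] by simp
    qed
    from this[of A ?B] this[of ?B A] show ?thesis
      using fin eq by (simp add: Int_commute)
  qed
  have split: "(\<integral>\<^sup>+y\<in>- S. ennreal (K (x - y)) \<partial>lborel) =
      (\<integral>\<^sup>+y\<in>- (S \<union> T). ennreal (K (x - y)) \<partial>lborel) + (\<integral>\<^sup>+y\<in>T - S. ennreal (K (x - y)) \<partial>lborel)"
    if [measurable]: "S \<in> sets borel" "T \<in> sets borel" for S T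
    by (subst nn_integral_add[symmetric]) (auto intro!: nn_integral_cong split: split_indicator)
  have "(\<integral>\<^sup>+y\<in>A - ?B. ennreal (K (x - y)) \<partial>lborel) \<le> (\<integral>\<^sup>+y\<in>A - ?B. ennreal k \<partial>lborel)"
    by (intro nn_integral_mono) (auto intro!: ennreal_leI outside split: split_indicator)
  also have "\<dots> = (\<integral>\<^sup>+y\<in>?B - A. ennreal k \<partial>lborel)"
    using diff by (simp add: nn_integral_cmult_indicator)
  also have "\<dots> \<le> (\<integral>\<^sup>+y\<in>?B - A. ennreal (K (x - y)) \<partial>lborel)"
    using AE_lborel_singleton[of x]
    by (intro nn_integral_mono_AE) (auto intro!: ennreal_leI inside split: split_indicator)
  finally have "(\<integral>\<^sup>+y\<in>- ?B. ennreal (K (x - y)) \<partial>lborel) \<le> (\<integral>\<^sup>+y\<in>- A. ennreal (K (x - y)) \<partial>lborel)"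
    using split[of ?B A] split[of A ?B] by (auto simp: Un_commute intro!: add_left_mono)
  then show ?thesis by (simp add: tail_translate[OF r])
qed

lemma tail_lower_bound:
  assumes lim: "filterlim (\<lambda>r. r powr (2 * s) * tail r) at_top (at_right 0)"
    and s: "0 \<le> s" and R: "0 < R"
  obtains c where "0 < c" "\<And>r. 0 < r \<Longrightarrow> r \<le> R \<Longrightarrow> c * r powr (- (2 * s)) \<le> tail r"
proof -
  have "eventually (\<lambda>r. 1 \<le> r powr (2 * s) * tail r) (at_right 0)"
    using lim by (simp add: filterlim_at_top)
  then obtain b where b: "0 < b" "\<And>r. 0 < r \<Longrightarrow> r < b \<Longrightarrow> 1 \<le> r powr (2 * s) * tail r"
    by (auto simp: eventually_at_right_field)
  define c where "c = min 1 (b powr (2 * s) * tail R)"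
  have c: "0 < c" using b tail_pos[OF R] by (simp add: c_def)
  have "c * r powr (- (2 * s)) \<le> tail r" if r: "0 < r" "r \<le> R" for r
  proof -
    have "c \<le> r powr (2 * s) * tail r"
    proof (cases "r < b")
      case True
      with b r show ?thesis by (auto simp: c_def min_le_iff_disj)
    next
      case False
      then have "b powr (2 * s) * tail R \<le> r powr (2 * s) * tail r"
        using r b s tail_antimono[of r R] tail_nonneg by (intro mult_mono powr_mono2) auto
      then show ?thesis by (simp add: c_def)
    qed
    then show ?thesis using r by (simp add: powr_minus field_simps)
  qed
  with c that show thesis by blast
qed

text \<open>
  The kernel need not dominate \<open>\<bar>z\<bar> powr (- DIM('a) - 2 * s)\<close> pointwise, because it may stay constant over
  long ranges of radii. Still, \<open>r ^ DIM('a) * K\<close> is large on the ball of radius \<open>r\<close> for suitable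
  \<open>r\<close>: otherwise each halving of the radius would add only a bounded amount to the tail, which would
  then grow at most logarithmically.
\<close>

lemma kernel_concentration:
  assumes lim: "filterlim (\<lambda>r. r powr (2 * s) * tail r) at_top (at_right 0)"
    and s: "0 < s"
  obtains r where "0 < r" "\<And>z. z \<noteq> 0 \<Longrightarrow> norm z \<le> r \<Longrightarrow> M \<le> r ^ DIM('a) * K z"
proof (rule ccontr)
  note result = that
  assume contra: "\<not> thesis"
  have *: "\<exists>z. z \<noteq> 0 \<and> norm z \<le> r \<and> r ^ DIM('a) * K z < M" if r: "0 < r" for r
    using result[of r] contra r by (meson not_le)
  define L where "L = max M 1 * 2 ^ DIM('a) * measure lborel (ball (0::'a) 1)"
  \<comment> \<open>halving the radius increases the tail by at most a constant\<close>
  have doubling: "tail r \<le> tail (2 * r) + L" if r: "0 < r" for r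
  proof -
    obtain z where z: "z \<noteq> 0" "norm z \<le> r" "r ^ DIM('a) * K z < M"
      using *[OF r] by blast
    define m where "m = max M 1 / r ^ DIM('a)"
    have bound: "K y \<le> m" if "y \<notin> ball 0 r" for y
    proof -
      have "K y \<le> K z" using that r z by (intro K_decreasing) auto
      also have "\<dots> \<le> m" using z r by (simp add: m_def field_simps)
      finally show ?thesis .
    qed
    have [measurable]: "ball (0::'a) (2 * r) \<in> sets borel" by simp
    have "ennreal (tail r) = (\<integral>\<^sup>+y\<in>- ball 0 r. ennreal (K y) \<partial>lborel)"
      by (simp add: tail_nn_integral r)
    also have "\<dots> \<le> (\<integral>\<^sup>+y. ennreal (K y) * indicator (- ball 0 (2 * r)) y +
        ennreal m * indicator (ball 0 (2 * r)) y \<partial>lborel)"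
      using bound by (intro nn_integral_mono) (auto intro!: ennreal_leI split: split_indicator)
    also have "\<dots> = ennreal (tail (2 * r)) +
        ennreal m * emeasure lborel (ball (0::'a) (2 * r))"
      using r by (subst nn_integral_add) (auto simp: tail_nn_integral nn_integral_cmult_indicator)
    also have "emeasure lborel (ball (0::'a) (2 * r)) =
        ennreal ((2 * r) ^ DIM('a) * measure lborel (ball (0::'a) 1))"
      using emeasure_lborel_ball_finite[of "0::'a" "2 * r"] r content_ball_conv_unit_ball[of "2 * r" "0::'a"]
      by (subst emeasure_eq_ennreal_measure) auto
    also have "ennreal m * \<dots> = ennreal L"
      using r by (subst ennreal_mult[symmetric]) (auto simp: L_def m_def power_mult_distrib)
    also have "ennreal (tail (2 * r)) + ennreal L = ennreal (tail (2 * r) + L)"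
      by (rule ennreal_plus[symmetric]) (auto simp: tail_nonneg L_def)
    finally show ?thesis
      by (subst (asm) ennreal_le_iff) (auto simp: tail_nonneg L_def intro!: add_nonneg_nonneg)
  qed
  have linear: "tail (1 / 2 ^ j) \<le> tail 1 + real j * L" for j
  proof (induction j)
    case (Suc j)
    have "tail (1 / 2 ^ Suc j) \<le> tail (1 / 2 ^ j) + L"
      using doubling[of "1 / 2 ^ Suc j"] by simp
    with Suc show ?case by (simp add: algebra_simps)
  qed simp
  obtain c where c: "0 < c" "\<And>r. 0 < r \<Longrightarrow> r \<le> 1 \<Longrightarrow> c * r powr (- (2 * s)) \<le> tail r"
    using tail_lower_bound[OF lim, of 1] s by auto
  define b where "b = (2::real) powr (2 * s)"
  have b: "1 < b" unfolding b_def using s by simp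
  have "c \<le> tail 1 * (1 / b) ^ j + L * (real j / b ^ j)" for j
  proof -
    have "c * b ^ j = c * (1 / 2 ^ j) powr (- (2 * s))"
      by (simp add: b_def powr_powr powr_realpow[symmetric] powr_minus powr_divide mult_ac
          flip: powr_realpow)
    also have "\<dots> \<le> tail 1 + real j * L"
      using c(2)[of "1 / 2 ^ j"] linear[of j] by simp
    finally show ?thesis using b by (simp add: field_simps power_divide)
  qed
  moreover have "(\<lambda>j. tail 1 * (1 / b) ^ j + L * (real j / b ^ j)) \<longlonglongrightarrow> tail 1 * 0 + L * 0"
    using b by (intro tendsto_intros LIMSEQ_power_zero lim_n_over_pown) auto
  ultimately have "c \<le> tail 1 * 0 + L * 0"
    by (intro LIMSEQ_le_const) auto
  with c show False by simp
qed

end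

section \<open>The weak-type Sobolev inequality\<close>

text \<open>
  The decay of the distribution function \<open>a\<close> is extracted from the recursion \<open>step\<close> by looking at
  \<open>S\<close>, the supremum of \<open>t powr q * a t\<close> over \<open>{0<..t}\<close>: it is finite, and the exponent \<open>q\<close> is chosen
  so that the recursion reads \<open>S \<le> D * S powr \<theta>\<close>.
\<close>

lemma weak_type_iteration:
  fixes a :: "real \<Rightarrow> real"
  assumes a: "\<And>t. 0 \<le> a t" "\<And>t. a t \<le> V"
    and \<theta>: "0 < \<theta>" "\<theta> < 1" and L: "0 \<le> L" and q: "q = 2 / (1 - \<theta>)"
    and step: "\<And>t. 0 < t \<Longrightarrow> a (2 * t) \<le> L / t\<^sup>2 * a t powr \<theta>"
    and t: "0 < t"
  shows "t powr q * a t \<le> (2 powr q * L) powr (1 / (1 - \<theta>))"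
proof -
  define D where "D = 2 powr q * L"
  define b where "b t = t powr q * a t" for t
  have q0: "0 < q" using \<theta> q by simp
  have q\<theta>: "q = 2 + q * \<theta>" using \<theta> q by (simp add: field_simps)
  have b0: "0 \<le> b t" for t unfolding b_def using a by simp
  have step': "b x \<le> D * b (x / 2) powr \<theta>" if x: "0 < x" for x
  proof -
    define y where "y = x / 2"
    have y: "0 < y" "x = 2 * y" using x by (auto simp: y_def)
    have "b x = 2 powr q * y powr q * a (2 * y)"
      using y by (simp add: b_def powr_mult)
    also have "\<dots> \<le> 2 powr q * y powr q * (L / y\<^sup>2 * a y powr \<theta>)"
      using step[OF y(1)] by (intro mult_left_mono) auto
    also have "y powr q = y\<^sup>2 * y powr (q * \<theta>)"
      using y by (subst q\<theta>) (simp add: powr_add powr_numeral)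
    also have "2 powr q * (y\<^sup>2 * y powr (q * \<theta>)) * (L / y\<^sup>2 * a y powr \<theta>) = D * b y powr \<theta>"
      using y a(1)[of y] by (simp add: D_def b_def powr_mult powr_powr)
    finally show ?thesis by (simp add: y_def)
  qed
  define S where "S = Sup (b ` {0<..t})"
  have bdd: "bdd_above (b ` {0<..t})"
  proof (rule bdd_aboveI2)
    fix x assume "x \<in> {0<..t}"
    then show "b x \<le> t powr q * V"
      unfolding b_def using a[of x] q0 by (intro mult_mono powr_mono2) auto
  qed
  have bS: "b x \<le> S" if "0 < x" "x \<le> t" for x
    unfolding S_def using that bdd by (intro cSup_upper) auto
  have D0: "0 \<le> D" using L by (simp add: D_def)
  have "S \<le> D * S powr \<theta>"
    unfolding S_def
  proof (rule cSup_least)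
    fix y assume "y \<in> b ` {0<..t}"
    then obtain x where x: "0 < x" "x \<le> t" "y = b x" by auto
    have "b x \<le> D * b (x / 2) powr \<theta>" by (rule step'[OF x(1)])
    also have "\<dots> \<le> D * S powr \<theta>"
      using x D0 \<theta> by (intro mult_left_mono powr_mono2 bS b0) auto
    finally show "y \<le> D * Sup (b ` {0<..t}) powr \<theta>" using x by (simp add: S_def)
  qed (use t in auto)
  have "S \<le> D powr (1 / (1 - \<theta>))"
  proof (cases "S \<le> 0")
    case True
    then show ?thesis by (meson order_trans powr_ge_zero)
  next
    case False
    have "S powr (1 - \<theta>) * S powr \<theta> \<le> D * S powr \<theta>"
      using \<open>S \<le> D * S powr \<theta>\<close> False by (simp flip: powr_add)
    then have "S powr (1 - \<theta>) \<le> D" using False by simp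
    then have "(S powr (1 - \<theta>)) powr (1 / (1 - \<theta>)) \<le> D powr (1 / (1 - \<theta>))"
      using \<theta> by (intro powr_mono2) auto
    then show ?thesis using \<theta> False by (simp add: powr_powr)
  qed
  with bS[of t] t show ?thesis by (simp add: b_def D_def)
qed

text \<open>
  A function that is weakly of class \<open>q\<close> has small \<open>L\<^sup>p\<close> mass on high superlevel sets when \<open>p < q\<close>;
  the set \<open>{\<tau> < \<bar>f\<bar>}\<close> is cut into the dyadic layers \<open>{2 ^ j * \<tau> < \<bar>f\<bar> \<le> 2 ^ (j + 1) * \<tau>}\<close>.
\<close>

lemma nn_integral_powr_superlevel_le:
  fixes f :: "'a \<Rightarrow> real"
  assumes [measurable]: "f \<in> borel_measurable M"
    and p: "0 < p" "p < q" and \<tau>: "0 < \<tau>"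
    and fin: "\<And>t. 0 < t \<Longrightarrow> emeasure M {x \<in> space M. t < \<bar>f x\<bar>} \<noteq> \<infinity>"
    and weak: "\<And>t. 0 < t \<Longrightarrow> t powr q * measure M {x \<in> space M. t < \<bar>f x\<bar>} \<le> B"
  shows "(\<integral>\<^sup>+x\<in>{x \<in> space M. \<tau> < \<bar>f x\<bar>}. ennreal (\<bar>f x\<bar> powr p) \<partial>M)
    \<le> ennreal (2 powr p * B * \<tau> powr (p - q) / (1 - 2 powr (p - q)))"
proof -
  define A where "A j = {x \<in> space M. 2 ^ j * \<tau> < \<bar>f x\<bar>}" for j
  have A [measurable]: "A j \<in> sets M" for j unfolding A_def by measurable
  define w where "w j = 2 powr p * (2 ^ j * \<tau>) powr p" for j :: nat
  define \<rho> where "\<rho> = (2::real) powr (p - q)"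
  have \<rho>: "0 < \<rho>" "\<rho> < 1" using p by (auto simp: \<rho>_def intro: powr_less_one)
  have B0: "0 \<le> B" using weak[of 1] by (rule order_trans[rotated]) auto
  have "(\<integral>\<^sup>+x\<in>{x \<in> space M. \<tau> < \<bar>f x\<bar>}. ennreal (\<bar>f x\<bar> powr p) \<partial>M)
      \<le> (\<integral>\<^sup>+x. (\<Sum>j. ennreal (w j) * indicator (A j) x) \<partial>M)"
  proof (rule nn_integral_mono)
    fix x assume x: "x \<in> space M"
    show "ennreal (\<bar>f x\<bar> powr p) * indicator {x \<in> space M. \<tau> < \<bar>f x\<bar>} x
      \<le> (\<Sum>j. ennreal (w j) * indicator (A j) x)"
    proof (cases "\<tau> < \<bar>f x\<bar>")
      case True
      obtain n where n: "\<bar>f x\<bar> / \<tau> < 2 ^ n"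
        using real_arch_pow[of 2 "\<bar>f x\<bar> / \<tau>"] by auto
      define k where "k = (LEAST n. \<bar>f x\<bar> \<le> 2 ^ n * \<tau>)"
      have k: "\<bar>f x\<bar> \<le> 2 ^ k * \<tau>"
        unfolding k_def by (rule LeastI[of _ n]) (use n \<tau> in \<open>simp add: field_simps\<close>)
      with True have "k \<noteq> 0" by (intro notI) simp
      then obtain j where j: "k = Suc j" by (cases k) auto
      have "\<not> \<bar>f x\<bar> \<le> 2 ^ j * \<tau>"
        using not_less_Least[of j "\<lambda>n. \<bar>f x\<bar> \<le> 2 ^ n * \<tau>"] j by (simp add: k_def)
      then have "x \<in> A j" using x by (simp add: A_def)
      have "\<bar>f x\<bar> powr p \<le> (2 * (2 ^ j * \<tau>)) powr p"
        using k p by (intro powr_mono2) (auto simp: j)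
      also have "\<dots> = w j" using \<tau> by (simp add: w_def powr_mult)
      finally have "ennreal (\<bar>f x\<bar> powr p) \<le> ennreal (w j) * indicator (A j) x"
        using \<open>x \<in> A j\<close> by (simp add: ennreal_leI)
      also have "\<dots> \<le> (\<Sum>j. ennreal (w j) * indicator (A j) x)"
        using sum_le_suminf[of "\<lambda>j. ennreal (w j) * indicator (A j) x" "{j}"] by (simp del: sum_mult_indicator)
      finally show ?thesis using True x by simp
    qed simp
  qed
  also have "\<dots> = (\<Sum>j. \<integral>\<^sup>+x. ennreal (w j) * indicator (A j) x \<partial>M)"
    by (rule nn_integral_suminf) measurable
  also have "\<dots> = (\<Sum>j. ennreal (w j * measure M (A j)))"
  proof (rule arg_cong[where f = suminf], rule ext)
    fix j
    have "emeasure M (A j) = ennreal (measure M (A j))"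
      unfolding A_def using fin[of "2 ^ j * \<tau>"] \<tau> by (intro emeasure_eq_ennreal_measure) auto
    then show "(\<integral>\<^sup>+x. ennreal (w j) * indicator (A j) x \<partial>M) = ennreal (w j * measure M (A j))"
      by (simp add: nn_integral_cmult_indicator ennreal_mult w_def)
  qed
  also have "\<dots> \<le> (\<Sum>j. ennreal ((2 powr p * B * \<tau> powr (p - q)) * \<rho> ^ j))"
  proof (rule suminf_le)
    fix j
    let ?t = "2 ^ j * \<tau>"
    have t: "0 < ?t" using \<tau> by simp
    have "w j * measure M (A j) = 2 powr p * ?t powr (p - q) * (?t powr q * measure M (A j))"
      using t by (simp add: w_def powr_diff)
    also have "\<dots> \<le> 2 powr p * ?t powr (p - q) * B"
      unfolding A_def using weak[OF t] by (intro mult_left_mono) auto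
    also have "?t powr (p - q) = \<rho> ^ j * \<tau> powr (p - q)"
      using \<tau> by (simp add: powr_mult \<rho>_def powr_powr mult.commute flip: powr_realpow)
    finally show "ennreal (w j * measure M (A j)) \<le> ennreal ((2 powr p * B * \<tau> powr (p - q)) * \<rho> ^ j)"
      by (intro ennreal_leI) (simp add: mult_ac)
  qed auto
  also have "\<dots> = ennreal (\<Sum>j. (2 powr p * B * \<tau> powr (p - q)) * \<rho> ^ j)"
    using \<rho> B0 by (intro suminf_ennreal2) (auto intro!: summable_mult summable_geometric)
  also have "(\<Sum>j. (2 powr p * B * \<tau> powr (p - q)) * \<rho> ^ j) = 2 powr p * B * \<tau> powr (p - q) / (1 - \<rho>)"
    using \<rho> by (subst suminf_mult) (auto simp: suminf_geometric summable_geometric)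
  finally show ?thesis by (simp add: \<rho>_def)
qed

lemma measurable_fst_borel [measurable]: "(fst :: 'a::euclidean_space \<times> 'a \<Rightarrow> 'a) \<in> borel_measurable borel"
  by (intro borel_measurable_continuous_onI continuous_intros)

lemma measurable_snd_borel [measurable]: "(snd :: 'a::euclidean_space \<times> 'a \<Rightarrow> 'a) \<in> borel_measurable borel"
  by (intro borel_measurable_continuous_onI continuous_intros)

lemma nn_integral_lborel_pair:
  fixes f :: "'a::euclidean_space \<times> 'a \<Rightarrow> ennreal"
  assumes "f \<in> borel_measurable borel"
  shows "(\<integral>\<^sup>+z. f z \<partial>lborel) = (\<integral>\<^sup>+x. \<integral>\<^sup>+y. f (x, y) \<partial>lborel \<partial>lborel)"
proof -
  have "f \<in> borel_measurable (lborel \<Otimes>\<^sub>M lborel)"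
    using assms by (simp add: lborel_prod)
  then show ?thesis
    by (subst lborel_prod[symmetric]) (rule lborel.nn_integral_fst[symmetric])
qed

lemma AE_lborel_pair:
  fixes P :: "'a::euclidean_space \<Rightarrow> bool"
  assumes "AE x in lborel. P x"
  shows "AE z in (lborel :: ('a \<times> 'a) measure). P (fst z) \<and> P (snd z)"
proof -
  obtain N where N: "N \<in> null_sets lborel" "{x. \<not> P x} \<subseteq> N"
    using assms by (auto simp: eventually_ae_filter)
  have "N \<times> UNIV \<in> null_sets (lborel \<Otimes>\<^sub>M lborel)" "UNIV \<times> N \<in> null_sets (lborel \<Otimes>\<^sub>M lborel)"
    using N by (auto simp: null_sets_def lborel.emeasure_pair_measure_Times)
  then have "N \<times> UNIV \<union> UNIV \<times> N \<in> null_sets (lborel :: ('a \<times> 'a) measure)"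
    unfolding lborel_prod by (rule null_sets.Un)
  then show ?thesis
    by (rule AE_I') (use N in auto)
qed

context radial_kernel
begin

text \<open>
  The integrand of the bilinear form of the operator, as a function of the pair \<open>(x, y)\<close>.
\<close>

definition energy_density :: "('a \<Rightarrow> real) \<Rightarrow> ('a \<Rightarrow> real) \<Rightarrow> 'a \<times> 'a \<Rightarrow> real" where
  "energy_density u v z = (u (fst z) - u (snd z)) * (v (fst z) - v (snd z)) * K (fst z - snd z)"

text \<open>
  The bilinear form of the operator, and for \<open>u = v\<close> the energy of \<open>u\<close>. It is meaningful only where the density is integrable.
\<close>

definition form :: "('a \<Rightarrow> real) \<Rightarrow> ('a \<Rightarrow> real) \<Rightarrow> real" where
  "form u v = (LINT z|lborel. energy_density u v z)"

lemma energy_density_borel [measurable]: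
  "u \<in> borel_measurable borel \<Longrightarrow> v \<in> borel_measurable borel \<Longrightarrow> energy_density u v \<in> borel_measurable borel"
  unfolding energy_density_def[abs_def]
  by (intro borel_measurable_times borel_measurable_diff)
     (auto intro: measurable_compose[OF measurable_fst_borel] measurable_compose[OF measurable_snd_borel]
       measurable_compose[OF borel_measurable_diff[OF measurable_fst_borel measurable_snd_borel] K_borel])

lemma energy_density_nonneg: "0 \<le> energy_density u u z"
  unfolding energy_density_def using K_nonneg by simp

lemma form_self_nonneg: "0 \<le> form u u"
  unfolding form_def by (intro Bochner_Integration.integral_nonneg energy_density_nonneg)

lemma form_nn_integral:
  assumes "u \<in> borel_measurable borel" and "integrable lborel (energy_density u u)"
  shows "ennreal (form u u) = (\<integral>\<^sup>+x. \<integral>\<^sup>+y. ennreal (energy_density u u (x, y)) \<partial>lborel \<partial>lborel)"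
  unfolding form_def using assms energy_density_nonneg
  by (subst nn_integral_eq_integral[symmetric]) (auto intro!: nn_integral_lborel_pair)

lemma ball_of_measure:
  assumes "0 < m"
  defines "r \<equiv> (m / measure lborel (ball (0::'a) 1)) powr (1 / DIM('a))"
  shows "0 < r" "emeasure lborel (ball (x::'a) r) = ennreal m"
proof -
  let ?\<omega> = "measure lborel (ball (0::'a) 1)"
  have \<omega>: "0 < ?\<omega>" by (rule content_ball_pos) simp
  then show r: "0 < r" using assms by simp
  have "r ^ DIM('a) = m / ?\<omega>"
    using assms \<omega> r by (simp add: r_def powr_powr flip: powr_realpow)
  then have "measure lborel (ball x r) = m"
    using r \<omega> content_ball_conv_unit_ball[of r x] by simp
  then show "emeasure lborel (ball x r) = ennreal m"
    using emeasure_lborel_ball_finite[of x r] by (subst emeasure_eq_ennreal_measure) auto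
qed

text \<open>
  Between \<open>{2 * t < \<bar>u\<bar>}\<close> and the complement of \<open>{t < \<bar>u\<bar>}\<close> the function jumps by at least \<open>t\<close>, and
  each point of the former set sees at least the mass \<open>tail r\<close> in the latter.
\<close>

lemma form_ge_level_sets:
  fixes u :: "'a \<Rightarrow> real"
  assumes u [measurable]: "u \<in> borel_measurable borel" and int: "integrable lborel (energy_density u u)"
    and t: "0 < t"
    and fin: "\<And>t. 0 < t \<Longrightarrow> emeasure lborel {x. t < \<bar>u x\<bar>} \<noteq> \<infinity>"
    and r: "0 < r" "\<And>x. emeasure lborel {x. t < \<bar>u x\<bar>} = emeasure lborel (ball (x::'a) r)"
  shows "t\<^sup>2 * tail r * measure lborel {x. 2 * t < \<bar>u x\<bar>} \<le> form u u"
proof -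
  define A where "A = {x. t < \<bar>u x\<bar>}"
  define B where "B = {x. 2 * t < \<bar>u x\<bar>}"
  have [measurable]: "A \<in> sets borel" "B \<in> sets borel" unfolding A_def B_def by measurable
  have "ennreal (t\<^sup>2 * tail r * measure lborel B) = (\<integral>\<^sup>+x\<in>B. ennreal (t\<^sup>2 * tail r) \<partial>lborel)"
    using fin[of "2 * t"] t tail_nonneg
    by (simp add: nn_integral_cmult_indicator ennreal_mult B_def emeasure_eq_ennreal_measure)
  also have "\<dots> \<le> (\<integral>\<^sup>+x. \<integral>\<^sup>+y. ennreal (energy_density u u (x, y)) \<partial>lborel \<partial>lborel)"
  proof (rule nn_integral_mono)
    fix x
    show "ennreal (t\<^sup>2 * tail r) * indicator B x \<le> (\<integral>\<^sup>+y. ennreal (energy_density u u (x, y)) \<partial>lborel)"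
    proof (cases "x \<in> B")
      case True
      have "ennreal (t\<^sup>2 * tail r) \<le> ennreal (t\<^sup>2) * (\<integral>\<^sup>+y\<in>- A. ennreal (K (x - y)) \<partial>lborel)"
        using nn_integral_complement_ge_tail[of A r x] r
        by (auto simp: ennreal_mult tail_nonneg A_def intro!: mult_left_mono)
      also have "\<dots> = (\<integral>\<^sup>+y. ennreal (t\<^sup>2) * (ennreal (K (x - y)) * indicator (- A) y) \<partial>lborel)"
        by (rule nn_integral_cmult[symmetric]) measurable
      also have "\<dots> \<le> (\<integral>\<^sup>+y. ennreal (energy_density u u (x, y)) \<partial>lborel)"
      proof (rule nn_integral_mono)
        fix y
        have "t\<^sup>2 * K (x - y) \<le> energy_density u u (x, y)" if "y \<notin> A"
        proof -
          have "t \<le> \<bar>u x - u y\<bar>" using True that by (simp add: A_def B_def)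
          then have "t\<^sup>2 \<le> (u x - u y)\<^sup>2" using t by (simp add: abs_le_square_iff[symmetric])
          then show ?thesis
            using K_nonneg by (simp add: energy_density_def power2_eq_square mult_right_mono)
        qed
        then show "ennreal (t\<^sup>2) * (ennreal (K (x - y)) * indicator (- A) y) \<le> ennreal (energy_density u u (x, y))"
          using K_nonneg by (auto split: split_indicator simp: ennreal_leI simp flip: ennreal_mult)
      qed
      finally show ?thesis using True by simp
    qed simp
  qed
  also have "\<dots> = ennreal (form u u)" by (rule form_nn_integral[symmetric]) fact+
  finally show ?thesis
    using form_self_nonneg by (simp add: B_def ennreal_le_iff)
qed

text \<open>
  The Sobolev embedding of fractional order \<open>s\<close> in its weak form. The exponent \<open>q\<close> is the critical
  exponent \<open>2 * N / (N - 2 * s)\<close> for \<open>N = DIM('a)\<close>.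
\<close>

lemma weak_type_embedding:
  fixes S :: "'a set"
  assumes lim: "filterlim (\<lambda>r. r powr (2 * s) * tail r) at_top (at_right 0)"
    and s: "0 < s" "2 * s < DIM('a)"
    and S: "S \<in> sets borel" "emeasure lborel S \<noteq> \<infinity>"
  defines "q \<equiv> 2 / (1 - 2 * s / DIM('a))"
  obtains C where "0 < C"
    "\<And>u t. u \<in> borel_measurable borel \<Longrightarrow> integrable lborel (energy_density u u) \<Longrightarrow> (\<And>x. x \<notin> S \<Longrightarrow> u x = 0) \<Longrightarrow>
      0 < t \<Longrightarrow> t powr q * measure lborel {x. t < \<bar>u x\<bar>} \<le> (C * form u u) powr (q / 2)"
proof -
  let ?\<omega> = "measure lborel (ball (0::'a) 1)"
  define \<theta> where "\<theta> = 2 * s / DIM('a)"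
  have \<theta>: "0 < \<theta>" "\<theta> < 1" using s by (auto simp: \<theta>_def)
  \<comment> \<open>the summand \<open>1\<close> makes \<open>V\<close>, and with it \<open>R\<close>, positive even if \<open>S\<close> is a null set\<close>
  define V where "V = measure lborel S + 1"
  have V: "0 < V" unfolding V_def by (simp add: add_nonneg_pos)
  have \<omega>: "0 < ?\<omega>" by (rule content_ball_pos) simp
  define R where "R = (V / ?\<omega>) powr (1 / DIM('a))"
  have R: "0 < R" using \<omega> V by (simp add: R_def)
  obtain c where c: "0 < c" "\<And>r. 0 < r \<Longrightarrow> r \<le> R \<Longrightarrow> c * r powr (- (2 * s)) \<le> tail r"
    using tail_lower_bound[OF lim _ R] s by auto
  define C0 where "C0 = ?\<omega> powr (- \<theta>) / c"
  have C0: "0 < C0" using \<omega> c by (simp add: C0_def)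
  show thesis
  proof (rule that[of "2 powr q * C0"])
    show "0 < 2 powr q * C0" using C0 by simp
    fix u :: "'a \<Rightarrow> real" and t :: real
    assume u [measurable]: "u \<in> borel_measurable borel" and int: "integrable lborel (energy_density u u)"
      and supp: "\<And>x. x \<notin> S \<Longrightarrow> u x = 0" and t: "0 < t"
    \<comment> \<open>the value \<open>0\<close> for \<open>t \<le> 0\<close> keeps \<open>a\<close> bounded by \<open>V\<close>, as \<open>{x. t < \<bar>u x\<bar>}\<close> is the whole space for \<open>t < 0\<close>\<close>
    define a where "a t = (if 0 < t then measure lborel {x. t < \<bar>u x\<bar>} else 0)" for t
    have sub: "{x. t < \<bar>u x\<bar>} \<subseteq> S" if "0 < t" for t
      using supp that by (auto, metis abs_zero less_asym)
    have fin: "emeasure lborel {x. t < \<bar>u x\<bar>} \<noteq> \<infinity>" if "0 < t" for t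
      using emeasure_mono[OF sub[OF that], of lborel] S by (auto simp: top_unique)
    have a0: "0 \<le> a t" for t by (simp add: a_def)
    have aV: "a t \<le> V" for t
    proof (cases "0 < t")
      case True
      have "measure lborel {x. t < \<bar>u x\<bar>} \<le> measure lborel S"
        using sub[OF True] S by (intro measure_mono_fmeasurable) (auto simp: fmeasurable_def less_top)
      with True show ?thesis by (simp add: a_def V_def)
    qed (use V in \<open>simp add: a_def\<close>)
    have step: "a (2 * t) \<le> (C0 * form u u) / t\<^sup>2 * a t powr \<theta>" if t: "0 < t" for t
    proof (cases "a t = 0")
      case True
      have "a (2 * t) \<le> a t"
        unfolding a_def using t fin[OF t]
        by (auto intro!: measure_mono_fmeasurable simp: fmeasurable_def less_top)
      with True a0[of "2 * t"] show ?thesis by simp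
    next
      case False
      with a0[of t] have at: "0 < a t" by simp
      define r where "r = (a t / ?\<omega>) powr (1 / DIM('a))"
      have r: "0 < r" "emeasure lborel (ball (x::'a) r) = ennreal (a t)" for x
        unfolding r_def by (rule ball_of_measure[OF at])+
      have "r \<le> R"
        unfolding r_def R_def using aV[of t] \<omega> a0[of t]
        by (intro powr_mono2 divide_right_mono) auto
      have rs: "r powr (- (2 * s)) = a t powr (- \<theta>) * ?\<omega> powr \<theta>"
        using at \<omega> by (simp add: r_def powr_powr \<theta>_def powr_divide powr_minus field_simps)
      have em: "emeasure lborel {x. t < \<bar>u x\<bar>} = ennreal (a t)"
        using fin[OF t] t by (simp add: a_def emeasure_eq_ennreal_measure)
      have "t\<^sup>2 * (c * r powr (- (2 * s))) * a (2 * t) \<le> t\<^sup>2 * tail r * a (2 * t)"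
        using c(2)[OF r(1) \<open>r \<le> R\<close>] a0 by (intro mult_right_mono mult_left_mono) auto
      also have "\<dots> \<le> form u u"
        using form_ge_level_sets[OF u int t fin r(1)] em r(2) t by (simp add: a_def)
      finally have "a (2 * t) \<le> form u u / (t\<^sup>2 * (c * (a t powr (- \<theta>) * ?\<omega> powr \<theta>)))"
        using t c at \<omega> unfolding rs by (simp add: field_simps)
      also have "\<dots> = (C0 * form u u) / t\<^sup>2 * a t powr \<theta>"
        using t c at \<omega> by (simp add: C0_def powr_minus field_simps)
      finally show ?thesis .
    qed
    have "t powr q * a t \<le> (2 powr q * (C0 * form u u)) powr (1 / (1 - \<theta>))"
      using a0 aV \<theta> step t C0 form_self_nonneg[of u]
      by (intro weak_type_iteration[where V = V]) (auto simp: q_def \<theta>_def)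
    also have "1 / (1 - \<theta>) = q / 2"
      using \<theta> unfolding q_def \<theta>_def[symmetric] by (simp add: field_simps)
    finally show "t powr q * measure lborel {x. t < \<bar>u x\<bar>} \<le> (2 powr q * C0 * form u u) powr (q / 2)"
      using t by (simp add: a_def mult.assoc)
  qed
qed

end

section \<open>Compactness in the space of integrable functions\<close>

lemma bounded_family_convergent_subseq:
  fixes X :: "'i \<Rightarrow> nat \<Rightarrow> real"
  assumes "finite I" "\<And>i. i \<in> I \<Longrightarrow> Bseq (X i)"
  obtains r where "strict_mono r" "\<And>i. i \<in> I \<Longrightarrow> convergent (\<lambda>n. X i (r n))"
proof -
  have "\<exists>r. strict_mono r \<and> (\<forall>i\<in>I. convergent (\<lambda>n. X i (r n)))"
    using assms
  proof (induction I)
    case empty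
    show ?case by (intro exI[of _ id]) (auto simp: strict_mono_def)
  next
    case (insert j I)
    then obtain r where r: "strict_mono r" "\<forall>i\<in>I. convergent (\<lambda>n. X i (r n))" by auto
    have "bounded (range (\<lambda>n. X j (r n)))"
      using insert.prems[of j] by (auto simp: Bseq_eq_bounded intro: bounded_subset)
    then obtain l r' where r': "strict_mono r'" "((\<lambda>n. X j (r n)) \<circ> r') \<longlonglongrightarrow> l"
      using bounded_imp_convergent_subsequence by blast
    have "convergent (\<lambda>n. X i ((r \<circ> r') n))" if "i \<in> insert j I" for i
    proof (cases "i = j")
      case True
      with r'(2) show ?thesis by (auto simp: convergent_def o_def)
    next
      case False
      with that r(2) obtain l where "(\<lambda>n. X i (r n)) \<longlonglongrightarrow> l" by (auto simp: convergent_def)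
      from LIMSEQ_subseq_LIMSEQ[OF this r'(1)] show ?thesis by (auto simp: convergent_def o_def)
    qed
    moreover have "strict_mono (r \<circ> r')" using r(1) r'(1) by (rule strict_mono_o)
    ultimately show ?case by blast
  qed
  with that show thesis by blast
qed

context radial_kernel
begin

text \<open>
  Borel functions of finite energy that vanish everywhere (not merely almost everywhere) outside \<open>S\<close>.
\<close>

definition energy_space :: "'a set \<Rightarrow> ('a \<Rightarrow> real) set" where
  "energy_space S = {u \<in> borel_measurable borel. (\<forall>x. x \<notin> S \<longrightarrow> u x = 0) \<and> integrable lborel (energy_density u u)}"

lemma energy_spaceD:
  assumes "u \<in> energy_space S"
  shows "u \<in> borel_measurable borel" "x \<notin> S \<Longrightarrow> u x = 0" "integrable lborel (energy_density u u)"
  using assms by (auto simp: energy_space_def)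

lemma energy_density_integrable:
  assumes u: "u \<in> energy_space S" and v: "v \<in> energy_space S"
  shows "integrable lborel (energy_density u v)"
proof (rule Bochner_Integration.integrable_bound)
  show "integrable lborel (\<lambda>z. energy_density u u z + energy_density v v z)"
    using energy_spaceD(3)[OF u] energy_spaceD(3)[OF v] by simp
  show "energy_density u v \<in> borel_measurable lborel"
    using energy_spaceD(1)[OF u] energy_spaceD(1)[OF v] by simp
  have "\<bar>energy_density u v z\<bar> \<le> energy_density u u z + energy_density v v z" for z
  proof -
    have amgm: "\<bar>a * b\<bar> \<le> a * a + b * b" for a b :: real
    proof -
      have "2 * (\<bar>a\<bar> * \<bar>b\<bar>) \<le> a * a + b * b"
        using sum_squares_bound[of "\<bar>a\<bar>" "\<bar>b\<bar>"] by (simp add: power2_eq_square)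
      moreover have "0 \<le> \<bar>a\<bar> * \<bar>b\<bar>" by simp
      ultimately show ?thesis unfolding abs_mult by linarith
    qed
    show ?thesis
      unfolding energy_density_def abs_mult[of _ "K _"] abs_of_nonneg[OF K_nonneg] distrib_right[symmetric]
      by (rule mult_right_mono[OF amgm K_nonneg])
  qed
  then show "AE z in lborel. norm (energy_density u v z) \<le> norm (energy_density u u z + energy_density v v z)"
    using energy_density_nonneg by (auto intro!: AE_I2 order_trans[OF _ abs_ge_self])
qed

lemma
  assumes u: "u \<in> energy_space S" and v: "v \<in> energy_space S"
  shows energy_space_add_scale: "(\<lambda>x. u x + c * v x) \<in> energy_space S"
    and form_add_scale: "form (\<lambda>x. u x + c * v x) (\<lambda>x. u x + c * v x)
      = form u u + 2 * c * form u v + c\<^sup>2 * form v v"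
proof -
  let ?w = "\<lambda>x. u x + c * v x"
  have eq: "energy_density ?w ?w = (\<lambda>z. energy_density u u z + 2 * c * energy_density u v z + c\<^sup>2 * energy_density v v z)"
    by (rule ext) (simp add: energy_density_def algebra_simps power2_eq_square)
  have int: "integrable lborel (energy_density u u)" "integrable lborel (energy_density u v)" "integrable lborel (energy_density v v)"
    using u v by (auto intro: energy_density_integrable)
  show "?w \<in> energy_space S"
    using int energy_spaceD(1,2)[OF u] energy_spaceD(1,2)[OF v] by (auto simp: energy_space_def eq)
  show "form ?w ?w = form u u + 2 * c * form u v + c\<^sup>2 * form v v"
    unfolding form_def eq using int by simp
qed

lemma form_diff_le:
  assumes u: "u \<in> energy_space S" and v: "v \<in> energy_space S"
  shows "form (\<lambda>x. u x - v x) (\<lambda>x. u x - v x) \<le> 2 * form u u + 2 * form v v"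
  using form_add_scale[OF u v, of "-1"] form_add_scale[OF u v, of 1]
    form_self_nonneg[of "\<lambda>x. u x + 1 * v x"] by simp

text \<open>
  Up to an error \<open>\<delta>\<close>, the \<open>L\<^sup>1\<close> norm of a function of bounded energy is controlled by its integrals
  over finitely many balls of equal radius. On such a ball \<open>Q\<close> the function is compared with its
  mean; the difference is estimated through \<open>\<bar>d\<bar> \<le> \<eta> + d\<^sup>2 / (4 * \<eta>)\<close>, the square being absorbed by the
  energy because \<open>K\<close> is large compared with \<open>1 / measure lborel Q\<close> on differences of points of \<open>Q\<close>.
\<close>

lemma L1_le_ball_averages:
  fixes S :: "'a set"
  assumes lim: "filterlim (\<lambda>r. r powr (2 * s) * tail r) at_top (at_right 0)" and s: "0 < s"
    and S: "S \<in> sets borel" "bounded S" and \<delta>: "0 < \<delta>" and E: "0 \<le> E"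
  obtains k r B where "finite k" "0 \<le> B"
    "\<And>w. w \<in> energy_space S \<Longrightarrow> integrable lborel w \<Longrightarrow> form w w \<le> E \<Longrightarrow>
      (LINT x|lborel. \<bar>w x\<bar>) \<le> \<delta> + B * (\<Sum>a\<in>k. \<bar>LINT x:ball a r|lborel. w x\<bar>)"
proof -
  let ?\<omega> = "measure lborel (ball (0::'a) 1)"
  have \<omega>: "0 < ?\<omega>" by (rule content_ball_pos) simp
  have Sfin: "emeasure lborel S < \<infinity>" using S by (intro emeasure_bounded_finite)
  define V where "V = measure lborel S"
  have V0: "0 \<le> V" by (simp add: V_def)
  \<comment> \<open>\<open>\<eta>\<close> makes the constant part of the error at most \<open>\<delta> / 2\<close>, and \<open>M\<close> the energy part\<close>
  define \<eta> where "\<eta> = \<delta> / (2 * (V + 1))"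
  have \<eta>: "0 < \<eta>" "\<eta> * V \<le> \<delta> / 2" using \<delta> V0 by (auto simp: \<eta>_def field_simps)
  define M where "M = E * 2 ^ DIM('a) / (2 * \<eta> * ?\<omega> * \<delta>) + 1"
  have M: "0 < M" using E \<eta> \<omega> \<delta> by (auto simp: M_def intro!: add_nonneg_pos)
  obtain r where r: "0 < r" "\<And>z. z \<noteq> 0 \<Longrightarrow> norm z \<le> r \<Longrightarrow> M \<le> r ^ DIM('a) * K z"
    using kernel_concentration[OF lim s] by blast
  define m where "m = (r / 2) ^ DIM('a) * ?\<omega>"
  have m: "0 < m" using r \<omega> by (simp add: m_def)
  have ball_m: "emeasure lborel (ball a (r / 2)) = ennreal m" "measure lborel (ball a (r / 2)) = m" for a :: 'a
    using content_ball_conv_unit_ball[of "r / 2" a] r emeasure_lborel_ball_finite[of a "r / 2"]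
    by (auto simp: m_def emeasure_eq_ennreal_measure)
  define \<kappa> where "\<kappa> = M / r ^ DIM('a)"
  have \<kappa>: "0 < \<kappa>" "\<And>z. z \<noteq> 0 \<Longrightarrow> norm z \<le> r \<Longrightarrow> \<kappa> \<le> K z"
    using M r by (auto simp: \<kappa>_def field_simps)
  define c where "c = 1 / (4 * \<eta> * \<kappa>)"
  have c: "0 < c" using \<eta> \<kappa> by (simp add: c_def)
  have cE: "c * E / m \<le> \<delta> / 2"
  proof -
    have "c * E / m = E * 2 ^ DIM('a) / (4 * \<eta> * ?\<omega>) / M"
      using r \<eta> M \<omega> by (simp add: c_def \<kappa>_def m_def power_divide field_simps)
    also have "E * 2 ^ DIM('a) / (4 * \<eta> * ?\<omega>) = \<delta> / 2 * (M - 1)"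
      using \<eta> \<omega> \<delta> by (simp add: M_def field_simps)
    also have "\<delta> / 2 * (M - 1) / M \<le> \<delta> / 2" using M \<delta> by (simp add: field_simps)
    finally show ?thesis .
  qed
  have "compact (closure S)" using S by (simp add: compact_closure)
  then obtain k where k: "finite k" "closure S \<subseteq> (\<Union>a\<in>k. ball a (r / 2))"
    using r(1) unfolding compact_eq_totally_bounded by (meson half_gt_zero)
  show thesis
  proof (rule that[of k "V / m" "r / 2"])
    fix w assume w: "w \<in> energy_space S" and int: "integrable lborel w" and le: "form w w \<le> E"
    note [measurable] = energy_spaceD(1)[OF w] and supp = energy_spaceD(2)[OF w]
    define \<sigma> where "\<sigma> = (\<Sum>a\<in>k. \<bar>LINT x:ball a (r / 2)|lborel. w x\<bar>)"
    have \<sigma>0: "0 \<le> \<sigma>" by (simp add: \<sigma>_def sum_nonneg)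
    have [measurable]: "(\<lambda>z. ennreal (energy_density w w z)) \<in> borel_measurable (lborel \<Otimes>\<^sub>M lborel)"
      unfolding lborel_prod by measurable
    have point: "ennreal (m * \<bar>w x\<bar>) \<le> ennreal (\<eta> * m + \<sigma>) * indicator S x +
        ennreal c * (\<integral>\<^sup>+y. ennreal (energy_density w w (x, y)) \<partial>lborel)" for x
    proof (cases "x \<in> S")
      case True
      then obtain a where a: "a \<in> k" "x \<in> ball a (r / 2)"
        using k closure_subset by blast
      let ?Q = "ball a (r / 2)"
      have [measurable]: "?Q \<in> sets borel" by simp
      have setint: "set_integrable lborel ?Q w" 
        unfolding set_integrable_def by (rule integrable_mult_indicator[OF _ int]) simp
      have constint: "set_integrable lborel ?Q (\<lambda>y. w x)"
        using ball_m(1)[of a]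
        by (simp add: set_integrable_def integrable_indicator_iff less_top)
      have "m * w x = (LINT y:?Q|lborel. w x - w y) + (LINT y:?Q|lborel. w y)"
        using set_integral_diff(2)[OF constint setint] ball_m
        by (simp add: set_lebesgue_integral_def)
      then have "m * \<bar>w x\<bar> \<le> \<bar>LINT y:?Q|lborel. w x - w y\<bar> + \<bar>LINT y:?Q|lborel. w y\<bar>"
        using m by (metis abs_mult abs_of_pos abs_triangle_ineq)
      also have "\<bar>LINT y:?Q|lborel. w y\<bar> \<le> \<sigma>"
        unfolding \<sigma>_def by (rule member_le_sum[OF a(1)]) (use k in auto)
      also have "\<bar>LINT y:?Q|lborel. w x - w y\<bar> \<le> (LINT y:?Q|lborel. \<bar>w x - w y\<bar>)"
        using set_integral_norm_bound[OF set_integral_diff(1)[OF constint setint]] by simp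
      finally have 1: "m * \<bar>w x\<bar> \<le> (LINT y:?Q|lborel. \<bar>w x - w y\<bar>) + \<sigma>" by simp
      have "ennreal (LINT y:?Q|lborel. \<bar>w x - w y\<bar>) = (\<integral>\<^sup>+y. ennreal (indicator ?Q y * \<bar>w x - w y\<bar>) \<partial>lborel)"
        unfolding set_lebesgue_integral_def real_scaleR_def
        using set_integrable_abs[OF set_integral_diff(1)[OF constint setint]]
        by (intro nn_integral_eq_integral[symmetric]) (auto simp: set_integrable_def)
      also have "\<dots> \<le> (\<integral>\<^sup>+y. ennreal \<eta> * indicator ?Q y + ennreal c * ennreal (energy_density w w (x, y)) \<partial>lborel)"
      proof (rule nn_integral_mono)
        fix y
        have "\<bar>w x - w y\<bar> \<le> \<eta> + c * energy_density w w (x, y)" if y: "y \<in> ?Q"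
        proof (cases "x = y")
          case True
          with \<eta> show ?thesis by (simp add: energy_density_def)
        next
          case False
          let ?d = "\<bar>w x - w y\<bar>"
          have "norm (x - y) \<le> r" using a(2) y dist_triangle_half_r[of a x r y]
            by (simp add: dist_norm)
          with False have "\<kappa> \<le> K (x - y)" by (intro \<kappa>) auto
          then have "c * (?d\<^sup>2 * \<kappa>) \<le> c * energy_density w w (x, y)"
            using c by (intro mult_left_mono) (auto simp: energy_density_def power2_eq_square mult_left_mono)
          moreover have "?d \<le> \<eta> + c * (?d\<^sup>2 * \<kappa>)"
          proof -
            have "d \<le> \<eta> + d\<^sup>2 / (4 * \<eta>)" for d :: real
              using zero_le_power2[of "2 * \<eta> - d"] \<eta>(1)
              by (simp add: power2_eq_square field_simps)
            moreover have "c * (?d\<^sup>2 * \<kappa>) = ?d\<^sup>2 / (4 * \<eta>)"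
              using \<kappa>(1) by (simp add: c_def)
            ultimately show ?thesis by metis
          qed
          ultimately show ?thesis by linarith
        qed
        then show "ennreal (indicator ?Q y * \<bar>w x - w y\<bar>)
            \<le> ennreal \<eta> * indicator ?Q y + ennreal c * ennreal (energy_density w w (x, y))"
          using \<eta> c energy_density_nonneg
          by (auto split: split_indicator simp: ennreal_leI simp flip: ennreal_mult ennreal_plus)
      qed
      also have "\<dots> = ennreal (\<eta> * m) + ennreal c * (\<integral>\<^sup>+y. ennreal (energy_density w w (x, y)) \<partial>lborel)"
        using \<eta> m ball_m by (subst nn_integral_add) (auto simp: nn_integral_cmult nn_integral_cmult_indicator ennreal_mult)
      finally have 2: "ennreal (LINT y:?Q|lborel. \<bar>w x - w y\<bar>) \<le>
          ennreal (\<eta> * m) + ennreal c * (\<integral>\<^sup>+y. ennreal (energy_density w w (x, y)) \<partial>lborel)" .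
      have "0 \<le> (LINT y:?Q|lborel. \<bar>w x - w y\<bar>)"
        unfolding set_lebesgue_integral_def by (intro Bochner_Integration.integral_nonneg) auto
      then have "ennreal (m * \<bar>w x\<bar>) \<le> ennreal (LINT y:?Q|lborel. \<bar>w x - w y\<bar>) + ennreal \<sigma>"
        using ennreal_leI[OF 1] \<sigma>0 by simp
      also have "\<dots> \<le> ennreal (\<eta> * m) + ennreal c * (\<integral>\<^sup>+y. ennreal (energy_density w w (x, y)) \<partial>lborel) + ennreal \<sigma>"
        by (rule add_right_mono) (rule 2)
      also have "\<dots> = ennreal (\<eta> * m + \<sigma>) * indicator S x +
        ennreal c * (\<integral>\<^sup>+y. ennreal (energy_density w w (x, y)) \<partial>lborel)"
        using True \<sigma>0 \<eta> m by (simp add: add_ac)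
      finally show ?thesis .
    qed (simp add: supp)
    have "ennreal (m * (LINT x|lborel. \<bar>w x\<bar>)) = (\<integral>\<^sup>+x. ennreal (m * \<bar>w x\<bar>) \<partial>lborel)"
      using int m by (subst nn_integral_eq_integral) auto
    also have "\<dots> \<le> (\<integral>\<^sup>+x. ennreal (\<eta> * m + \<sigma>) * indicator S x +
        ennreal c * (\<integral>\<^sup>+y. ennreal (energy_density w w (x, y)) \<partial>lborel) \<partial>lborel)"
      by (intro nn_integral_mono point)
    also have "\<dots> = ennreal (\<eta> * m + \<sigma>) * emeasure lborel S + ennreal c * ennreal (form w w)"
      using S form_nn_integral[OF energy_spaceD(1,3)[OF w]]
      by (subst nn_integral_add) (auto simp: nn_integral_cmult nn_integral_cmult_indicator)
    also have "\<dots> = ennreal ((\<eta> * m + \<sigma>) * V + c * form w w)"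
      using Sfin \<eta> m \<sigma>0 c form_self_nonneg[of w]
      by (simp add: emeasure_eq_ennreal_measure V_def flip: ennreal_mult ennreal_plus)
    finally have "m * (LINT x|lborel. \<bar>w x\<bar>) \<le> (\<eta> * m + \<sigma>) * V + c * form w w"
      using \<eta> m \<sigma>0 c V0 form_self_nonneg[of w] by (subst (asm) ennreal_le_iff) auto
    also have "\<dots> \<le> (\<eta> * m + \<sigma>) * V + c * E"
      using le c by simp
    finally have "(LINT x|lborel. \<bar>w x\<bar>) \<le> \<eta> * V + c * E / m + V / m * \<sigma>"
      using m by (simp add: field_simps)
    with \<eta> cE show "(LINT x|lborel. \<bar>w x\<bar>) \<le> \<delta> + V / m * (\<Sum>a\<in>k. \<bar>LINT x:ball a (r / 2)|lborel. w x\<bar>)"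
      unfolding \<sigma>_def[symmetric] by linarith
  qed (use k V0 m in auto)
qed

text \<open>
  By \<open>L1_le_ball_averages\<close>, a subsequence along which finitely many ball integrals converge has
  mutual \<open>L\<^sup>1\<close> distances below any prescribed bound; a diagonal argument yields a Cauchy sequence.
\<close>

lemma compact_embedding_L1:
  fixes u :: "nat \<Rightarrow> 'a \<Rightarrow> real"
  assumes lim: "filterlim (\<lambda>r. r powr (2 * s) * tail r) at_top (at_right 0)" and s: "0 < s"
    and S: "S \<in> sets borel" "bounded S"
    and u: "\<And>n. u n \<in> energy_space S" "\<And>n. integrable lborel (u n)"
    and E: "\<And>n. form (u n) (u n) \<le> E" and L: "\<And>n. (LINT x|lborel. \<bar>u n x\<bar>) \<le> L"
  obtains r where "strict_mono r" "AE x in lborel. convergent (\<lambda>n. u (r n) x)"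
proof -
  define d where "d i j = (LINT x|lborel. \<bar>u i x - u j x\<bar>)" for i j
  define P where "P k \<sigma> \<longleftrightarrow> (\<forall>i j. d (\<sigma> i) (\<sigma> j) < 1 / real (Suc k))" for k and \<sigma> :: "nat \<Rightarrow> nat"
  have E0: "0 \<le> 4 * E" using E[of 0] form_self_nonneg[of "u 0"] by simp
  interpret subseqs P
  proof
    fix n and \<sigma> :: "nat \<Rightarrow> nat"
    define \<delta> where "\<delta> = 1 / real (Suc n) / 3"
    have \<delta>: "0 < \<delta>" by (simp add: \<delta>_def)
    have three: "3 * \<delta> = 1 / real (Suc n)" unfolding \<delta>_def by (simp del: of_nat_Suc)
    obtain k \<rho> B where k: "finite k" "0 \<le> B"
      "\<And>w. w \<in> energy_space S \<Longrightarrow> integrable lborel w \<Longrightarrow> form w w \<le> 4 * E \<Longrightarrow>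
        (LINT x|lborel. \<bar>w x\<bar>) \<le> \<delta> + B * (\<Sum>a\<in>k. \<bar>LINT x:ball a \<rho>|lborel. w x\<bar>)"
      using L1_le_ball_averages[OF lim s S \<delta> E0] by metis
    define X where "X a i = (LINT x:ball a \<rho>|lborel. u (\<sigma> i) x)" for a i
    have setint: "set_integrable lborel (ball a \<rho>) (u i)" for a i
      unfolding set_integrable_def by (rule integrable_mult_indicator[OF _ u(2)]) simp
    have "Bseq (X a)" for a
    proof (rule BseqI')
      fix i
      have "norm (X a i) \<le> (LINT x:ball a \<rho>|lborel. \<bar>u (\<sigma> i) x\<bar>)"
        unfolding X_def using set_integral_norm_bound[OF setint] by simp
      also have "\<dots> \<le> (LINT x|lborel. \<bar>u (\<sigma> i) x\<bar>)"
        unfolding set_lebesgue_integral_def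
        using set_integrable_abs[OF setint] u(2)
        by (intro integral_mono) (auto simp: set_integrable_def split: split_indicator)
      finally show "norm (X a i) \<le> L" using L[of "\<sigma> i"] by simp
    qed
    then obtain r where r: "strict_mono r" "\<And>a. a \<in> k \<Longrightarrow> convergent (\<lambda>i. X a (r i))"
      using bounded_family_convergent_subseq[OF k(1), of X] by blast
    define \<epsilon> where "\<epsilon> = \<delta> / ((B + 1) * (real (card k) + 1))"
    have \<epsilon>: "0 < \<epsilon>" using \<delta> k(2) by (simp add: \<epsilon>_def add_nonneg_pos)
    have "\<forall>a\<in>k. \<exists>N. \<forall>i\<ge>N. \<forall>j\<ge>N. \<bar>X a (r i) - X a (r j)\<bar> < \<epsilon>"
    proof
      fix a assume "a \<in> k"
      from r(2)[OF this] have "Cauchy (\<lambda>i. X a (r i))" by (simp add: Cauchy_convergent_iff)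
      from CauchyD[OF this \<epsilon>] show "\<exists>N. \<forall>i\<ge>N. \<forall>j\<ge>N. \<bar>X a (r i) - X a (r j)\<bar> < \<epsilon>" by simp
    qed
    then obtain N where N: "\<And>a i j. a \<in> k \<Longrightarrow> i \<ge> N a \<Longrightarrow> j \<ge> N a \<Longrightarrow> \<bar>X a (r i) - X a (r j)\<bar> < \<epsilon>"
      by metis
    define N0 where "N0 = Max (insert 0 (N ` k))"
    have N0: "N a \<le> N0" if "a \<in> k" for a unfolding N0_def using k(1) that by (intro Max_ge) auto
    define r' where "r' i = r (N0 + i)" for i
    have "strict_mono r'" using r(1) by (simp add: r'_def strict_mono_def)
    moreover have "P n (\<sigma> \<circ> r')"
      unfolding P_def
    proof (intro allI)
      fix i j
      let ?w = "\<lambda>x. u (\<sigma> (r' i)) x - u (\<sigma> (r' j)) x"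
      have "?w \<in> energy_space S"
        using energy_space_add_scale[OF u(1) u(1), of "\<sigma> (r' i)" "-1" "\<sigma> (r' j)"] by simp
      moreover have "form ?w ?w \<le> 4 * E"
        using form_diff_le[OF u(1) u(1), of "\<sigma> (r' i)" "\<sigma> (r' j)"] E[of "\<sigma> (r' i)"] E[of "\<sigma> (r' j)"] by simp
      ultimately have "d (\<sigma> (r' i)) (\<sigma> (r' j)) \<le> \<delta> + B * (\<Sum>a\<in>k. \<bar>LINT x:ball a \<rho>|lborel. ?w x\<bar>)"
        unfolding d_def using u(2) by (intro k(3)) auto
      also have "\<dots> \<le> \<delta> + B * (\<Sum>a\<in>k. \<epsilon>)"
      proof (intro add_left_mono mult_left_mono sum_mono)
        fix a assume a: "a \<in> k"
        have "(LINT x:ball a \<rho>|lborel. ?w x) = X a (r' i) - X a (r' j)"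
          unfolding X_def using setint by (intro set_integral_diff)
        with N[OF a, of "N0 + i" "N0 + j"] N0[OF a]
        show "\<bar>LINT x:ball a \<rho>|lborel. ?w x\<bar> \<le> \<epsilon>" by (simp add: r'_def)
      qed (fact k(2))
      also have "\<dots> < 3 * \<delta>"
      proof -
        have "B * (real (card k) * \<epsilon>) \<le> (B + 1) * ((real (card k) + 1) * \<epsilon>)"
          using k(2) \<epsilon> by (intro mult_mono) auto
        also have "\<dots> = \<delta>" using k(2) by (simp add: \<epsilon>_def)
        finally show ?thesis using \<delta> by simp
      qed
      finally show "d ((\<sigma> \<circ> r') i) ((\<sigma> \<circ> r') j) < 1 / real (Suc n)"
        unfolding three o_def .
    qed
    ultimately show "\<exists>r'. strict_mono r' \<and> P n (\<sigma> \<circ> r')" by blast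
  qed
  have diag: "P k (diagseq \<circ> (+) (Suc k))" for k
    by (rule diagseq_holds) (auto simp: P_def)
  have cauchy: "\<exists>N. \<forall>i\<ge>N. \<forall>j\<ge>N. (LINT x|lborel. norm (u (diagseq i) x - u (diagseq j) x)) < e" if e: "0 < e" for e
  proof -
    obtain k where k: "1 / real (Suc k) < e" using nat_approx_posE[OF e] by blast
    have "d (diagseq i) (diagseq j) < e" if "i \<ge> Suc k" "j \<ge> Suc k" for i j
    proof -
      have "d ((diagseq \<circ> (+) (Suc k)) (i - Suc k)) ((diagseq \<circ> (+) (Suc k)) (j - Suc k)) < 1 / real (Suc k)"
        using diag[of k] unfolding P_def by blast
      with that k show ?thesis by (simp add: o_def)
    qed
    then show ?thesis by (auto simp: d_def)
  qed
  obtain r where r: "strict_mono r" "AE x in lborel. Cauchy (\<lambda>i. u (diagseq (r i)) x)"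
    by (rule cauchy_L1_AE_cauchy_subseq[of lborel "\<lambda>i. u (diagseq i)"]) (use u(2) cauchy in auto)
  show thesis
  proof (rule that[of "diagseq \<circ> r"])
    show "strict_mono (diagseq \<circ> r)" using subseq_diagseq r(1) by (rule strict_mono_o)
    show "AE x in lborel. convergent (\<lambda>n. u ((diagseq \<circ> r) n) x)"
      using r(2) by (simp add: Cauchy_convergent_iff)
  qed
qed

end

section \<open>Pointwise inequalities for powers\<close>

text \<open>
  The graph of \<open>t \<mapsto> \<bar>t\<bar> powr p\<close> lies above its tangent at \<open>a\<close>; this is Young's inequality for \<open>\<bar>a\<bar> powr (p - 1) * \<bar>a + b\<bar>\<close>.
\<close>

lemma powr_tangent_le:
  fixes a b p :: real
  assumes p: "1 < p"
  shows "\<bar>a\<bar> powr p + p * (\<bar>a\<bar> powr (p - 2) * a * b) \<le> \<bar>a + b\<bar> powr p"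
proof (cases "a = 0")
  case False
  define c where "c = a + b"
  have "\<bar>a\<bar> powr (p - 1) * \<bar>c\<bar> \<le>
      (\<bar>a\<bar> powr (p - 1)) powr (p / (p - 1)) / (p / (p - 1)) + \<bar>c\<bar> powr p / p"
    using p by (intro Youngs_inequality) (auto simp: field_simps)
  also have "(\<bar>a\<bar> powr (p - 1)) powr (p / (p - 1)) = \<bar>a\<bar> powr p"
    using p by (simp add: powr_powr)
  finally have young: "p * (\<bar>a\<bar> powr (p - 1) * \<bar>c\<bar>) \<le> (p - 1) * \<bar>a\<bar> powr p + \<bar>c\<bar> powr p"
    using p by (simp add: field_simps)
  have abs: "\<bar>a\<bar> powr (p - 1) = \<bar>a\<bar> powr (p - 2) * \<bar>a\<bar>" "\<bar>a\<bar> powr p = \<bar>a\<bar> powr (p - 2) * (a * a)"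
    using False powr_add[of "\<bar>a\<bar>" "p - 2" 1] powr_add[of "\<bar>a\<bar>" "p - 2" 2]
    by (auto simp: powr_numeral power2_eq_square)
  have "\<bar>a\<bar> powr (p - 2) * (a * c) \<le> \<bar>a\<bar> powr (p - 2) * (\<bar>a\<bar> * \<bar>c\<bar>)"
    by (intro mult_left_mono) (auto simp: abs_mult[symmetric])
  then have le: "p * (\<bar>a\<bar> powr (p - 2) * (a * c)) \<le> p * (\<bar>a\<bar> powr (p - 1) * \<bar>c\<bar>)"
    using p by (auto simp: abs mult.assoc)
  have eq: "\<bar>a\<bar> powr (p - 2) * (a * c) = \<bar>a\<bar> powr p + \<bar>a\<bar> powr (p - 2) * a * b"
    by (simp add: c_def abs algebra_simps)
  have "p * (\<bar>a\<bar> powr p + \<bar>a\<bar> powr (p - 2) * a * b) \<le> (p - 1) * \<bar>a\<bar> powr p + \<bar>c\<bar> powr p"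
    using le young unfolding eq by (rule order_trans)
  then show ?thesis by (simp add: c_def algebra_simps)
qed (use p in auto)

lemma abs_powr_mult_le:
  fixes a b p :: real
  assumes p: "1 < p"
  shows "\<bar>\<bar>a\<bar> powr (p - 2) * a * b\<bar> \<le> \<bar>a\<bar> powr p + \<bar>b\<bar> powr p"
proof (cases "a = 0")
  case False
  define M where "M = max \<bar>a\<bar> \<bar>b\<bar>"
  have "\<bar>\<bar>a\<bar> powr (p - 2) * a * b\<bar> = \<bar>a\<bar> powr (p - 1) * \<bar>b\<bar>"
    using False powr_add[of "\<bar>a\<bar>" "p - 2" 1] by (simp add: abs_mult)
  also have "\<dots> \<le> M powr (p - 1) * M"
    using p by (intro mult_mono powr_mono2) (auto simp: M_def)
  also have "\<dots> = M powr p"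
    using False powr_add[of M "p - 1" 1] by (simp add: M_def)
  also have "\<dots> \<le> \<bar>a\<bar> powr p + \<bar>b\<bar> powr p"
    by (auto simp: M_def max_def)
  finally show ?thesis .
qed auto

section \<open>The subcritical problem: integrability\<close>

text \<open>
  The data of the problem, with an order \<open>s\<close> at which the tail of the kernel still diverges fast enough
  and which is so close to the order of the kernel that \<open>p\<close> lies below the critical exponent of \<open>s\<close>.
\<close>

locale subcritical = radial_kernel K
  for K :: "'a::euclidean_space \<Rightarrow> real" +
  fixes \<Omega> :: "'a set" and s p :: real
  assumes open_\<Omega>: "open \<Omega>" and bounded_\<Omega>: "bounded \<Omega>" and nonempty_\<Omega>: "\<Omega> \<noteq> {}"
    and tail_lim: "filterlim (\<lambda>r. r powr (2 * s) * tail r) at_top (at_right 0)"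
    and s: "0 < s" "2 * s < DIM('a)"
    and p: "2 < p" "p < 2 / (1 - 2 * s / DIM('a))"
begin

abbreviation "H \<equiv> energy_space \<Omega>"

text \<open>
  The \<open>p\<close>-th power of the \<open>L\<^sup>p\<close> norm.
\<close>

definition Lp :: "('a \<Rightarrow> real) \<Rightarrow> real" where
  "Lp u = (LINT x|lborel. \<bar>u x\<bar> powr p)"

lemma \<Omega>_borel [measurable]: "\<Omega> \<in> sets borel"
  using open_\<Omega> by simp

lemma \<Omega>_finite: "emeasure lborel \<Omega> < \<infinity>"
  using bounded_\<Omega> by (rule emeasure_bounded_finite)

lemma indicator_\<Omega>_integrable: "integrable lborel (indicat_real \<Omega>)"
  using \<Omega>_finite by (simp add: integrable_indicator_iff)

lemma H_borel [measurable_dest]: "u \<in> H \<Longrightarrow> u \<in> borel_measurable borel"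
  by (rule energy_spaceD)

lemma Lp_nonneg: "0 \<le> Lp u"
  unfolding Lp_def by (intro Bochner_Integration.integral_nonneg) auto

text \<open>
  Functions of bounded energy are uniformly \<open>p\<close>-integrable; this is where \<open>p\<close> is subcritical.
\<close>

lemma uniform_Lp_tail:
  assumes E: "0 \<le> E" and \<delta>: "0 < \<delta>"
  obtains \<tau> where "0 < \<tau>" "\<And>u. u \<in> H \<Longrightarrow> form u u \<le> E \<Longrightarrow>
    (\<integral>\<^sup>+x\<in>{x. \<tau> < \<bar>u x\<bar>}. ennreal (\<bar>u x\<bar> powr p) \<partial>lborel) \<le> ennreal \<delta>"
proof -
  define q where "q = 2 / (1 - 2 * s / DIM('a))"
  have q: "p < q" using p by (simp add: q_def)
  have "emeasure lborel \<Omega> \<noteq> \<infinity>" using \<Omega>_finite by simp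
  from weak_type_embedding[OF tail_lim s \<Omega>_borel this, folded q_def]
  obtain C where C: "0 < C"
    "\<And>u t. u \<in> borel_measurable borel \<Longrightarrow> integrable lborel (energy_density u u) \<Longrightarrow> (\<And>x. x \<notin> \<Omega> \<Longrightarrow> u x = 0) \<Longrightarrow>
      0 < t \<Longrightarrow> t powr q * measure lborel {x. t < \<bar>u x\<bar>} \<le> (C * form u u) powr (q / 2)"
    by metis
  define B where "B = (C * E) powr (q / 2)"
  define \<rho> where "\<rho> = 1 - 2 powr (p - q)"
  have \<rho>: "0 < \<rho>" using q by (simp add: \<rho>_def powr_less_one)
  define D where "D = 2 powr p * (B + 1) / \<rho>"
  have D: "0 < D" using \<rho> by (simp add: D_def B_def add_nonneg_pos)
  define \<tau> where "\<tau> = (\<delta> / D) powr (1 / (p - q))"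
  have \<tau>: "0 < \<tau>" using \<delta> D by (simp add: \<tau>_def)
  have \<tau>D: "\<tau> powr (p - q) = \<delta> / D" using \<delta> D q by (simp add: \<tau>_def powr_powr)
  show thesis
  proof (rule that[OF \<tau>])
    fix u assume u: "u \<in> H" and le: "form u u \<le> E"
    note [measurable] = H_borel[OF u]
    have weak: "t powr q * measure lborel {x \<in> space lborel. t < \<bar>u x\<bar>} \<le> B" if "0 < t" for t
    proof -
      have "t powr q * measure lborel {x. t < \<bar>u x\<bar>} \<le> (C * form u u) powr (q / 2)"
        using energy_spaceD[OF u] that by (intro C(2)) auto
      also have "\<dots> \<le> B"
        unfolding B_def using C(1) le q p form_self_nonneg[of u] by (intro powr_mono2) auto
      finally show ?thesis by simp
    qed
    have fin: "emeasure lborel {x \<in> space lborel. t < \<bar>u x\<bar>} \<noteq> \<infinity>" if "0 < t" for t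
    proof -
      have "{x \<in> space lborel. t < \<bar>u x\<bar>} \<subseteq> \<Omega>"
        using energy_spaceD(2)[OF u] that by (auto, metis abs_zero less_asym)
      from emeasure_mono[OF this, of lborel] show ?thesis using \<Omega>_finite by (auto simp: top_unique)
    qed
    have "(\<integral>\<^sup>+x\<in>{x \<in> space lborel. \<tau> < \<bar>u x\<bar>}. ennreal (\<bar>u x\<bar> powr p) \<partial>lborel)
      \<le> ennreal (2 powr p * B * \<tau> powr (p - q) / (1 - 2 powr (p - q)))"
      using p q \<tau> fin weak by (intro nn_integral_powr_superlevel_le) auto
    also have "\<dots> \<le> ennreal \<delta>"
    proof (rule ennreal_leI)
      have "2 powr p * B / \<rho> \<le> D" unfolding D_def using \<rho> by (simp add: divide_right_mono)
      then have "2 powr p * B / \<rho> * (\<delta> / D) \<le> D * (\<delta> / D)"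
        using \<delta> D by (intro mult_right_mono) auto
      then show "2 powr p * B * \<tau> powr (p - q) / (1 - 2 powr (p - q)) \<le> \<delta>"
        using D unfolding \<tau>D \<rho>_def[symmetric] by (simp add: mult.commute)
    qed
    finally show "(\<integral>\<^sup>+x\<in>{x. \<tau> < \<bar>u x\<bar>}. ennreal (\<bar>u x\<bar> powr p) \<partial>lborel) \<le> ennreal \<delta>" by simp
  qed
qed

lemma Lp_bounded_by_energy:
  assumes E: "0 \<le> E"
  obtains M where "0 \<le> M"
    "\<And>u. u \<in> H \<Longrightarrow> form u u \<le> E \<Longrightarrow> (\<integral>\<^sup>+x. ennreal (\<bar>u x\<bar> powr p) \<partial>lborel) \<le> ennreal M"
proof -
  obtain \<tau> where \<tau>: "0 < \<tau>" "\<And>u. u \<in> H \<Longrightarrow> form u u \<le> E \<Longrightarrow>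
      (\<integral>\<^sup>+x\<in>{x. \<tau> < \<bar>u x\<bar>}. ennreal (\<bar>u x\<bar> powr p) \<partial>lborel) \<le> ennreal 1"
    using uniform_Lp_tail[OF E zero_less_one] by blast
  show thesis
  proof (rule that)
    show "0 \<le> \<tau> powr p * measure lborel \<Omega> + 1" by simp
    fix u assume u: "u \<in> H" and le: "form u u \<le> E"
    note [measurable] = H_borel[OF u]
    have "(\<integral>\<^sup>+x. ennreal (\<bar>u x\<bar> powr p) \<partial>lborel) \<le> (\<integral>\<^sup>+x. ennreal (\<tau> powr p) * indicator \<Omega> x +
        ennreal (\<bar>u x\<bar> powr p) * indicator {x. \<tau> < \<bar>u x\<bar>} x \<partial>lborel)"
    proof (rule nn_integral_mono)
      fix x
      show "ennreal (\<bar>u x\<bar> powr p) \<le> ennreal (\<tau> powr p) * indicator \<Omega> x +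
        ennreal (\<bar>u x\<bar> powr p) * indicator {x. \<tau> < \<bar>u x\<bar>} x"
      proof (cases "\<tau> < \<bar>u x\<bar>")
        case False
        then have "\<bar>u x\<bar> powr p \<le> \<tau> powr p" using p by (intro powr_mono2) auto
        with False energy_spaceD(2)[OF u, of x] show ?thesis
          by (cases "x \<in> \<Omega>") (auto intro: ennreal_leI)
      qed simp
    qed
    also have "\<dots> = ennreal (\<tau> powr p) * emeasure lborel \<Omega> +
       (\<integral>\<^sup>+x\<in>{x. \<tau> < \<bar>u x\<bar>}. ennreal (\<bar>u x\<bar> powr p) \<partial>lborel)"
      by (subst nn_integral_add) (auto simp: nn_integral_cmult_indicator)
    also have "\<dots> \<le> ennreal (\<tau> powr p) * emeasure lborel \<Omega> + ennreal 1"
      by (intro add_left_mono \<tau>(2) u le)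
    also have "\<dots> = ennreal (\<tau> powr p * measure lborel \<Omega> + 1)"
      using \<Omega>_finite by (simp add: emeasure_eq_ennreal_measure ennreal_mult)
    finally show "(\<integral>\<^sup>+x. ennreal (\<bar>u x\<bar> powr p) \<partial>lborel) \<le> ennreal (\<tau> powr p * measure lborel \<Omega> + 1)" .
  qed
qed

lemma Lp_integrable:
  assumes u: "u \<in> H"
  shows "integrable lborel (\<lambda>x. \<bar>u x\<bar> powr p)"
proof (rule integrableI_bounded)
  show "(\<lambda>x. \<bar>u x\<bar> powr p) \<in> borel_measurable lborel" using H_borel[OF u] by measurable
  obtain M where "(\<integral>\<^sup>+x. ennreal (\<bar>u x\<bar> powr p) \<partial>lborel) \<le> ennreal M"
    using Lp_bounded_by_energy[OF form_self_nonneg[of u]] u by blast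
  then show "(\<integral>\<^sup>+x. ennreal (norm (\<bar>u x\<bar> powr p)) \<partial>lborel) < \<infinity>"
    by (simp add: le_less_trans)
qed

lemma abs_le_indicator_plus_powr:
  assumes u: "u \<in> H" and r: "0 < r" "r \<le> p"
  shows "\<bar>u x\<bar> powr r \<le> indicator \<Omega> x + \<bar>u x\<bar> powr p"
proof (cases "\<bar>u x\<bar> \<le> 1")
  case True
  then have "\<bar>u x\<bar> powr r \<le> 1" using r by (simp add: powr_le1)
  then show ?thesis using energy_spaceD(2)[OF u, of x]
    by (cases "x \<in> \<Omega>") (auto intro: add_increasing2)
next
  case False
  then have "\<bar>u x\<bar> powr r \<le> \<bar>u x\<bar> powr p" using r by (intro powr_mono) auto
  then show ?thesis by (auto intro: add_increasing split: split_indicator)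
qed

lemma
  assumes u: "u \<in> H"
  shows H_integrable: "integrable lborel u"
    and H_L1_le: "(LINT x|lborel. \<bar>u x\<bar>) \<le> measure lborel \<Omega> + Lp u"
    and H_L2: "integrable lborel (\<lambda>x. (u x)\<^sup>2)"
proof -
  note [measurable] = H_borel[OF u]
  have int: "integrable lborel (\<lambda>x. indicator \<Omega> x + \<bar>u x\<bar> powr p)"
    using indicator_\<Omega>_integrable Lp_integrable[OF u] by (rule Bochner_Integration.integrable_add)
  have 1: "\<bar>u x\<bar> \<le> indicator \<Omega> x + \<bar>u x\<bar> powr p" for x
    using abs_le_indicator_plus_powr[OF u, of 1] p by simp
  have 2: "(u x)\<^sup>2 \<le> indicator \<Omega> x + \<bar>u x\<bar> powr p" for x
    using abs_le_indicator_plus_powr[OF u, of 2] p by (simp add: powr_numeral)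
  show i: "integrable lborel u"
    by (rule Bochner_Integration.integrable_bound[OF int]) (auto intro!: AE_I2 order_trans[OF 1])
  show "integrable lborel (\<lambda>x. (u x)\<^sup>2)"
    by (rule Bochner_Integration.integrable_bound[OF int]) (auto intro!: AE_I2 order_trans[OF 2])
  have "(LINT x|lborel. \<bar>u x\<bar>) \<le> (LINT x|lborel. indicator \<Omega> x + \<bar>u x\<bar> powr p)"
    using i int 1 by (intro integral_mono) auto
  also have "\<dots> = measure lborel \<Omega> + Lp u"
    unfolding Lp_def using indicator_\<Omega>_integrable Lp_integrable[OF u] by simp
  finally show "(LINT x|lborel. \<bar>u x\<bar>) \<le> measure lborel \<Omega> + Lp u" .
qed

lemma
  assumes u: "u \<in> H"
  shows H_scale: "(\<lambda>x. c * u x) \<in> H"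
    and form_scale_left: "form (\<lambda>x. c * u x) v = c * form u v"
    and form_scale: "form (\<lambda>x. c * u x) (\<lambda>x. c * u x) = c\<^sup>2 * form u u"
    and Lp_scale: "Lp (\<lambda>x. c * u x) = \<bar>c\<bar> powr p * Lp u"
proof -
  show "(\<lambda>x. c * u x) \<in> H"
    using energy_space_add_scale[OF u u, of "c - 1"] by (simp add: algebra_simps)
  have left: "form (\<lambda>x. c * u x) v = c * form u v" for v
  proof -
    have "energy_density (\<lambda>x. c * u x) v = (\<lambda>z. c * energy_density u v z)"
      by (rule ext) (simp add: energy_density_def algebra_simps)
    then show ?thesis by (simp add: form_def)
  qed
  then show "form (\<lambda>x. c * u x) v = c * form u v" .
  have "energy_density (\<lambda>x. c * u x) (\<lambda>x. c * u x) = (\<lambda>z. c\<^sup>2 * energy_density u u z)"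
    by (rule ext) (simp add: energy_density_def algebra_simps power2_eq_square)
  then show "form (\<lambda>x. c * u x) (\<lambda>x. c * u x) = c\<^sup>2 * form u u" by (simp add: form_def)
  show "Lp (\<lambda>x. c * u x) = \<bar>c\<bar> powr p * Lp u"
    by (simp add: Lp_def abs_mult powr_mult)
qed


text \<open>
  The truncated cone over a ball has finite energy: it is 1-Lipschitz with values in \<open>{0..1}\<close>, so its
  increments are controlled by the weight in the Levy condition.
\<close>

lemma bump_in_energy_space:
  assumes R: "0 < R" "R \<le> 1" and ball: "ball x0 R \<subseteq> \<Omega>"
  defines "\<phi> \<equiv> \<lambda>x. max 0 (R - dist x x0)"
  shows "\<phi> \<in> H"
proof -
  define B where "B = ball x0 R"
  have [measurable]: "B \<in> sets borel" by (simp add: B_def)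
  have \<phi> [measurable]: "\<phi> \<in> borel_measurable borel"
    unfolding \<phi>_def by (intro borel_measurable_continuous_onI continuous_intros)
  have off: "\<phi> x = 0" if "x \<notin> B" for x
    using that by (simp add: \<phi>_def B_def dist_commute)
  define m where "m z = min ((norm z)\<^sup>2) 1 * K z" for z :: 'a
  have [measurable]: "m \<in> borel_measurable borel" unfolding m_def[abs_def] by measurable
  have m0: "0 \<le> m z" for z using K_nonneg by (simp add: m_def)
  have le: "energy_density \<phi> \<phi> (x, y) \<le> indicator B x * m (y - x) + indicator B y * m (x - y)" for x y
  proof (cases "x \<in> B \<or> y \<in> B")
    case True
    have "\<bar>\<phi> x - \<phi> y\<bar> \<le> norm (x - y)"
      using dist_triangle[of x x0 y] dist_triangle[of y x0 x] dist_commute[of x y]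
      by (auto simp: \<phi>_def max_def dist_norm[symmetric])
    then have "(\<phi> x - \<phi> y)\<^sup>2 \<le> (norm (x - y))\<^sup>2" by (simp add: abs_le_square_iff[symmetric])
    moreover have "0 \<le> \<phi> a" "\<phi> a \<le> 1" for a
      using R zero_le_dist[of a x0] unfolding \<phi>_def by linarith+
    then have "\<bar>\<phi> x - \<phi> y\<bar> \<le> 1" by (smt (verit))
    then have "(\<phi> x - \<phi> y)\<^sup>2 \<le> 1"
      using power_le_one[of "\<bar>\<phi> x - \<phi> y\<bar>" 2] by simp
    ultimately have "energy_density \<phi> \<phi> (x, y) \<le> m (x - y)"
      using K_nonneg by (auto simp: energy_density_def m_def power2_eq_square intro!: mult_right_mono)
    moreover have "m (y - x) = m (x - y)" by (simp add: m_def K_even[of y x] norm_minus_commute)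
    ultimately show ?thesis using True m0[of "x - y"]
      by (auto split: split_indicator)
  next
    case False
    then show ?thesis using off[of x] off[of y] by (simp add: energy_density_def)
  qed
  have [measurable]: "(\<lambda>z. ennreal (indicator B (fst z) * m (snd z - fst z))) \<in> borel_measurable (lborel \<Otimes>\<^sub>M lborel)"
    "(\<lambda>z. ennreal (indicator B (snd z) * m (fst z - snd z))) \<in> borel_measurable (lborel \<Otimes>\<^sub>M lborel)"
    by measurable
  define J where "J = (\<integral>\<^sup>+x. \<integral>\<^sup>+y. ennreal (indicator B x * m (y - x)) \<partial>lborel \<partial>lborel)"
  have "J = (\<integral>\<^sup>+x. indicator B x * (\<integral>\<^sup>+y. ennreal (m y) \<partial>lborel) \<partial>lborel)"
    unfolding J_def
  proof (rule nn_integral_cong)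
    fix x
    show "(\<integral>\<^sup>+y. ennreal (indicator B x * m (y - x)) \<partial>lborel) = indicator B x * (\<integral>\<^sup>+y. ennreal (m y) \<partial>lborel)"
      using nn_integral_translate[where f = "\<lambda>y. ennreal (m y)" and x = x]
      by (cases "x \<in> B") auto
  qed
  also have "\<dots> = emeasure lborel B * (\<integral>\<^sup>+y. ennreal (m y) \<partial>lborel)"
    by (simp add: nn_integral_multc)
  also have "(\<integral>\<^sup>+y. ennreal (m y) \<partial>lborel) = ennreal (LINT y|lborel. m y)"
    using K_levy m0 by (intro nn_integral_eq_integral) (auto simp: m_def)
  also have "emeasure lborel B * \<dots> < \<infinity>"
    using emeasure_lborel_ball_finite[of x0 R] by (simp add: B_def ennreal_mult_less_top)
  finally have J: "J < \<infinity>" .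
  \<comment> \<open>the mirror image of \<open>J\<close>, with the roles of the variables exchanged\<close>
  have "(\<integral>\<^sup>+x. \<integral>\<^sup>+y. ennreal (indicator B y * m (x - y)) \<partial>lborel \<partial>lborel) = J"
    unfolding J_def
    using lborel_pair.Fubini[of "\<lambda>z. ennreal (indicator B (snd z) * m (fst z - snd z))"] by simp
  then have "(\<integral>\<^sup>+x. \<integral>\<^sup>+y. ennreal (indicator B x * m (y - x)) + ennreal (indicator B y * m (x - y)) \<partial>lborel \<partial>lborel) = J + J"
    by (subst nn_integral_add) (auto simp: nn_integral_add J_def)
  moreover have "(\<integral>\<^sup>+z. ennreal (norm (energy_density \<phi> \<phi> z)) \<partial>lborel) = (\<integral>\<^sup>+x. \<integral>\<^sup>+y. ennreal (energy_density \<phi> \<phi> (x, y)) \<partial>lborel \<partial>lborel)"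
    using energy_density_nonneg by (subst nn_integral_lborel_pair) auto
  moreover have "\<dots> \<le> (\<integral>\<^sup>+x. \<integral>\<^sup>+y. ennreal (indicator B x * m (y - x)) + ennreal (indicator B y * m (x - y)) \<partial>lborel \<partial>lborel)"
    using le m0 by (intro nn_integral_mono) (simp add: ennreal_leI flip: ennreal_plus)
  ultimately have "(\<integral>\<^sup>+z. ennreal (norm (energy_density \<phi> \<phi> z)) \<partial>lborel) < \<infinity>"
    using J by (metis ennreal_add_less_top infinity_ennreal_def le_less_trans)
  then have "integrable lborel (energy_density \<phi> \<phi>)"
    by (intro integrableI_bounded) auto
  moreover have "\<phi> x = 0" if "x \<notin> \<Omega>" for x
    using that ball by (intro off) (auto simp: B_def)
  ultimately show ?thesis using \<phi> by (simp add: energy_space_def)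
qed

section \<open>Existence of a minimiser\<close>

lemma Lp_normalization:
  assumes u: "u \<in> H" and pos: "0 < Lp u"
  defines "c \<equiv> Lp u powr (- (1 / p))"
  shows "(\<lambda>x. c * u x) \<in> H" "Lp (\<lambda>x. c * u x) = 1"
    "form (\<lambda>x. c * u x) (\<lambda>x. c * u x) = form u u / Lp u powr (2 / p)"
proof -
  show "(\<lambda>x. c * u x) \<in> H" using u by (rule H_scale)
  have "\<bar>c\<bar> powr p = Lp u powr (- 1)"
    using p by (simp add: c_def powr_powr)
  then show "Lp (\<lambda>x. c * u x) = 1"
    using pos by (simp add: Lp_scale[OF u] powr_minus)
  have "c\<^sup>2 = Lp u powr (- (2 / p))"
    unfolding power2_eq_square c_def by (simp flip: powr_add)
  then show "form (\<lambda>x. c * u x) (\<lambda>x. c * u x) = form u u / Lp u powr (2 / p)"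
    by (simp add: form_scale[OF u] powr_minus divide_inverse)
qed

text \<open>
  The energy bound passes to the limit by Fatou's lemma. The lower bound on \<open>Lp\<close> does so because \<open>\<bar>u n\<bar> powr p\<close>
  truncated at height \<open>\<tau>\<close> converges by dominated convergence, while the rest is uniformly small.
\<close>

lemma AE_limit_of_bounded_energy:
  fixes u :: "nat \<Rightarrow> 'a \<Rightarrow> real" and v :: "'a \<Rightarrow> real"
  assumes u: "\<And>n. u n \<in> H" and v [measurable]: "v \<in> borel_measurable borel"
    and off: "\<And>x. x \<notin> \<Omega> \<Longrightarrow> v x = 0"
    and conv: "AE x in lborel. (\<lambda>n. u n x) \<longlonglongrightarrow> v x"
    and E: "\<And>n. form (u n) (u n) \<le> E n" and lim: "E \<longlonglongrightarrow> e" and Lp1: "\<And>n. Lp (u n) = 1"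
  shows "v \<in> H" "form v v \<le> e" "1 \<le> Lp v"
proof -
  note [measurable] = H_borel[OF u]
  have E0: "0 \<le> E n" for n using E[of n] form_self_nonneg[of "u n"] by simp
  have e0: "0 \<le> e" using lim E0 by (intro LIMSEQ_le_const) auto
  have "(\<integral>\<^sup>+z. ennreal (energy_density v v z) \<partial>lborel) = (\<integral>\<^sup>+z. liminf (\<lambda>n. ennreal (energy_density (u n) (u n) z)) \<partial>lborel)"
  proof (rule nn_integral_cong_AE)
    from AE_lborel_pair[OF conv]
    show "AE z in lborel. ennreal (energy_density v v z) = liminf (\<lambda>n. ennreal (energy_density (u n) (u n) z))"
    proof eventually_elim
      case (elim z)
      then have "(\<lambda>n. ennreal (energy_density (u n) (u n) z)) \<longlonglongrightarrow> ennreal (energy_density v v z)"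
        unfolding energy_density_def by (intro tendsto_ennrealI tendsto_intros) auto
      then show ?case by (intro lim_imp_Liminf[symmetric]) auto
    qed
  qed
  also have "\<dots> \<le> liminf (\<lambda>n. \<integral>\<^sup>+z. ennreal (energy_density (u n) (u n) z) \<partial>lborel)"
    by (rule nn_integral_liminf) measurable
  also have "(\<lambda>n. \<integral>\<^sup>+z. ennreal (energy_density (u n) (u n) z) \<partial>lborel) = (\<lambda>n. ennreal (form (u n) (u n)))"
    unfolding form_def using energy_spaceD(3)[OF u] energy_density_nonneg
    by (intro ext nn_integral_eq_integral) auto
  also have "liminf (\<lambda>n. ennreal (form (u n) (u n))) \<le> liminf (\<lambda>n. ennreal (E n))"
    using E by (intro Liminf_mono always_eventually allI ennreal_leI)
  also have "\<dots> = ennreal e"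
    using tendsto_ennrealI[OF lim] by (intro lim_imp_Liminf) auto
  finally have le: "(\<integral>\<^sup>+z. ennreal (energy_density v v z) \<partial>lborel) \<le> ennreal e" .
  have int: "integrable lborel (energy_density v v)"
  proof (rule integrableI_bounded)
    show "(\<integral>\<^sup>+z. ennreal (norm (energy_density v v z)) \<partial>lborel) < \<infinity>"
      using le energy_density_nonneg[of v] by (auto intro: le_less_trans)
  qed simp
  show vH: "v \<in> H" using int off by (simp add: energy_space_def)
  have form_eq: "ennreal (form v v) = (\<integral>\<^sup>+z. ennreal (energy_density v v z) \<partial>lborel)"
    unfolding form_def using int energy_density_nonneg by (intro nn_integral_eq_integral[symmetric]) auto
  show "form v v \<le> e"
    using le unfolding form_eq[symmetric] ennreal_le_iff[OF e0] .
  have "Bseq E" by (rule convergent_imp_Bseq[OF convergentI[OF lim]])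
  then obtain B where "0 < B" and "\<forall>n. norm (E n) \<le> B" by (rule BseqE)
  then have B: "E n \<le> B" "0 \<le> B" for n
    using abs_le_D1[of "E n" B] by auto
  have "1 \<le> Lp v + \<delta>" if \<delta>: "0 < \<delta>" for \<delta>
  proof -
    obtain \<tau> where \<tau>: "0 < \<tau>" "\<And>u. u \<in> H \<Longrightarrow> form u u \<le> B \<Longrightarrow>
      (\<integral>\<^sup>+x\<in>{x. \<tau> < \<bar>u x\<bar>}. ennreal (\<bar>u x\<bar> powr p) \<partial>lborel) \<le> ennreal \<delta>"
      using uniform_Lp_tail[OF B(2) \<delta>] by blast
    define T where "T f = (LINT x|lborel. min \<bar>f x\<bar> \<tau> powr p)" for f :: "'a \<Rightarrow> real"
    have Tint: "integrable lborel (\<lambda>x. min \<bar>f x\<bar> \<tau> powr p)" if "f \<in> H" for f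
    proof (rule Bochner_Integration.integrable_bound[OF Lp_integrable[OF that]])
      show "(\<lambda>x. min \<bar>f x\<bar> \<tau> powr p) \<in> borel_measurable lborel" using H_borel[OF that] by measurable
      show "AE x in lborel. norm (min \<bar>f x\<bar> \<tau> powr p) \<le> norm (\<bar>f x\<bar> powr p)"
        using \<tau>(1) p by (auto intro!: AE_I2 powr_mono2)
    qed
    have "(\<lambda>n. T (u n)) \<longlonglongrightarrow> T v"
      unfolding T_def
    proof (rule integral_dominated_convergence[where w = "\<lambda>x. \<tau> powr p * indicator \<Omega> x"])
      show "integrable lborel (\<lambda>x. \<tau> powr p * indicator \<Omega> x)"
        using indicator_\<Omega>_integrable by simp
      show "AE x in lborel. (\<lambda>n. min \<bar>u n x\<bar> \<tau> powr p) \<longlonglongrightarrow> min \<bar>v x\<bar> \<tau> powr p"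
        using conv
      proof eventually_elim
        case (elim x)
        show ?case using \<tau>(1) p
          by (intro tendsto_powr' tendsto_min tendsto_rabs elim tendsto_const) auto
      qed
      show "AE x in lborel. norm (min \<bar>u n x\<bar> \<tau> powr p) \<le> \<tau> powr p * indicator \<Omega> x" for n
      proof (rule AE_I2)
        fix x
        show "norm (min \<bar>u n x\<bar> \<tau> powr p) \<le> \<tau> powr p * indicator \<Omega> x"
          using energy_spaceD(2)[OF u, of x n] \<tau>(1) p
          by (cases "x \<in> \<Omega>") (auto intro!: powr_mono2)
      qed
    qed measurable
    moreover have "1 - \<delta> \<le> T (u n)" for n
    proof -
      have "ennreal 1 = (\<integral>\<^sup>+x. ennreal (\<bar>u n x\<bar> powr p) \<partial>lborel)"
        using Lp1[of n] Lp_integrable[OF u] unfolding Lp_def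
        by (subst nn_integral_eq_integral) auto
      also have "\<dots> \<le> (\<integral>\<^sup>+x. ennreal (min \<bar>u n x\<bar> \<tau> powr p) +
          ennreal (\<bar>u n x\<bar> powr p) * indicator {x. \<tau> < \<bar>u n x\<bar>} x \<partial>lborel)"
        by (intro nn_integral_mono) (auto split: split_indicator simp: min_def)
      also have "\<dots> = ennreal (T (u n)) + (\<integral>\<^sup>+x\<in>{x. \<tau> < \<bar>u n x\<bar>}. ennreal (\<bar>u n x\<bar> powr p) \<partial>lborel)"
        unfolding T_def using Tint[OF u]
        by (subst nn_integral_add) (auto simp: nn_integral_eq_integral)
      also have "\<dots> \<le> ennreal (T (u n)) + ennreal \<delta>"
        using E[of n] B(1)[of n] by (intro add_left_mono \<tau>(2) u) simp
      also have "\<dots> = ennreal (T (u n) + \<delta>)"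
        using \<delta> by (intro ennreal_plus[symmetric]) (auto simp: T_def intro!: Bochner_Integration.integral_nonneg)
      finally have "1 \<le> T (u n) + \<delta>"
        by (subst (asm) ennreal_le_iff)
           (use \<delta> in \<open>auto simp: T_def intro!: add_nonneg_nonneg Bochner_Integration.integral_nonneg\<close>)
      then show ?thesis by simp
    qed
    ultimately have "1 - \<delta> \<le> T v" by (intro LIMSEQ_le_const) auto
    also have "\<dots> \<le> Lp v"
      unfolding T_def Lp_def using Tint[OF vH] Lp_integrable[OF vH] \<tau>(1) p
      by (intro integral_mono powr_mono2) auto
    finally show ?thesis by simp
  qed
  then show "1 \<le> Lp v" by (rule field_le_epsilon)
qed

lemma ex_normalized: "\<exists>u\<in>H. Lp u = 1"
proof -
  obtain x0 where "x0 \<in> \<Omega>" using nonempty_\<Omega> by blast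
  then obtain e where e: "0 < e" "ball x0 e \<subseteq> \<Omega>"
    using open_\<Omega> by (meson openE)
  define R where "R = min e 1"
  have R: "0 < R" "R \<le> 1" "ball x0 R \<subseteq> \<Omega>" using e by (auto simp: R_def)
  define \<phi> where "\<phi> = (\<lambda>x. max 0 (R - dist x x0))"
  have \<phi>: "\<phi> \<in> H" unfolding \<phi>_def using R by (rule bump_in_energy_space)
  have "Lp \<phi> \<noteq> 0"
  proof
    assume "Lp \<phi> = 0"
    then have "AE x in lborel. \<bar>\<phi> x\<bar> powr p = 0"
      unfolding Lp_def using Lp_integrable[OF \<phi>]
      by (subst (asm) integral_nonneg_eq_0_iff_AE) auto
    then have "AE x in lborel. x \<notin> ball x0 R"
      by eventually_elim (auto simp: \<phi>_def dist_commute)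
    then have "ball x0 R \<in> null_sets lborel"
      by (simp add: AE_iff_null_sets)
    then show False using content_ball_pos[OF R(1), of x0] by (simp add: null_sets_def measure_def)
  qed
  then have pos: "0 < Lp \<phi>" using Lp_nonneg[of \<phi>] by simp
  from Lp_normalization(1,2)[OF \<phi> pos] show ?thesis by blast
qed

text \<open>
  The second conjunct is the homogeneous form of minimality: the constraint \<open>Lp v = 1\<close> has been removed
  by scaling.
\<close>

lemma ex_minimizer:
  "\<exists>u\<in>H. Lp u = 1 \<and> (\<forall>v\<in>H. form u u * Lp v powr (2 / p) \<le> form v v)"
proof -
  define F where "F = (\<lambda>u. form u u) ` {u \<in> H. Lp u = 1}"
  define e where "e = Inf F"
  have ne: "F \<noteq> {}" using ex_normalized by (auto simp: F_def)
  have bdd: "bdd_below F"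
    by (rule bdd_belowI[of _ 0]) (auto simp: F_def form_self_nonneg)
  have "\<exists>u\<in>H. Lp u = 1 \<and> form u u \<le> e + 1 / real (Suc n)" for n
  proof -
    have "e < e + 1 / real (Suc n)" by simp
    then obtain y where "y \<in> F" "y < e + 1 / real (Suc n)"
      unfolding e_def using cInf_lessD[OF ne] by metis
    then show ?thesis by (auto simp: F_def intro: less_imp_le)
  qed
  then obtain u where u: "\<And>n. u n \<in> H" "\<And>n. Lp (u n) = 1"
    "\<And>n. form (u n) (u n) \<le> e + 1 / real (Suc n)" by metis
  have bound: "form (u n) (u n) \<le> e + 1" for n
  proof -
    have "1 / real (Suc n) \<le> 1" by simp
    with u(3)[of n] show ?thesis by linarith
  qed
  have L1: "(LINT x|lborel. \<bar>u n x\<bar>) \<le> measure lborel \<Omega> + 1" for n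
    using H_L1_le[OF u(1), of n] u(2)[of n] by simp
  obtain r where r: "strict_mono r" "AE x in lborel. convergent (\<lambda>n. u (r n) x)"
    by (rule compact_embedding_L1[OF tail_lim s(1) \<Omega>_borel bounded_\<Omega> u(1) H_integrable[OF u(1)] bound L1])
  note [measurable] = H_borel[OF u(1)]
  define v where "v x = lim (\<lambda>n. u (r n) x)" for x
  have v [measurable]: "v \<in> borel_measurable borel" unfolding v_def[abs_def] by measurable
  have off: "v x = 0" if "x \<notin> \<Omega>" for x
    using energy_spaceD(2)[OF u(1) that] by (simp add: v_def)
  have conv: "AE x in lborel. (\<lambda>n. u (r n) x) \<longlonglongrightarrow> v x"
    using r(2) by eventually_elim (simp add: v_def convergent_LIMSEQ_iff)
  have "(\<lambda>n. e + 1 / real (Suc (r n))) \<longlonglongrightarrow> e + 0"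
    using LIMSEQ_subseq_LIMSEQ[OF LIMSEQ_Suc[OF lim_1_over_n] r(1)]
    by (intro tendsto_intros) (simp add: o_def)
  then have lim: "(\<lambda>n. e + 1 / real (Suc (r n))) \<longlonglongrightarrow> e" by simp
  note vfacts = AE_limit_of_bounded_energy[OF u(1) v off conv u(3) lim u(2)]
  have vpos: "0 < Lp v" using vfacts(3) by simp
  \<comment> \<open>only \<open>1 \<le> Lp v\<close> is known, so the limit is scaled down, which does not increase its energy\<close>
  define w where "w x = Lp v powr (- (1 / p)) * v x" for x
  have w: "w \<in> H" "Lp w = 1" "form w w = form v v / Lp v powr (2 / p)"
    unfolding w_def using Lp_normalization[OF vfacts(1) vpos] by auto
  have "1 \<le> Lp v powr (2 / p)" using vfacts(3) p by (intro ge_one_powr_ge_zero) auto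
  then have "form w w \<le> form v v"
    using form_self_nonneg[of v] by (simp add: w(3) divide_le_eq mult_le_cancel_left1)
  with vfacts(2) have we: "form w w \<le> e" by simp
  have "form w w * Lp \<phi> powr (2 / p) \<le> form \<phi> \<phi>" if \<phi>: "\<phi> \<in> H" for \<phi>
  proof (cases "Lp \<phi> = 0")
    case True
    then show ?thesis using p form_self_nonneg by simp
  next
    case False
    with Lp_nonneg[of \<phi>] have pos: "0 < Lp \<phi>" by simp
    have "form \<phi> \<phi> / Lp \<phi> powr (2 / p) \<in> F"
      unfolding F_def Lp_normalization(3)[OF \<phi> pos, symmetric] using Lp_normalization(1,2)[OF \<phi> pos] by blast
    then have "e \<le> form \<phi> \<phi> / Lp \<phi> powr (2 / p)"
      unfolding e_def using bdd by (rule cInf_lower)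
    with we have "form w w \<le> form \<phi> \<phi> / Lp \<phi> powr (2 / p)" by simp
    then show ?thesis using pos by (simp add: pos_le_divide_eq)
  qed
  with w show ?thesis by blast
qed

text \<open>
  If the energy of \<open>u\<close> vanished, all multiples of \<open>u\<close> would have energy \<open>0\<close>, but their \<open>L\<^sup>p\<close> norms are unbounded, against \<open>Lp_bounded_by_energy\<close>.
\<close>

lemma form_pos:
  assumes u: "u \<in> H" and ne: "Lp u \<noteq> 0"
  shows "0 < form u u"
proof (rule ccontr)
  assume "\<not> 0 < form u u"
  with form_self_nonneg[of u] have zero: "form u u = 0" by simp
  obtain M where M: "0 \<le> M" "\<And>u. u \<in> H \<Longrightarrow> form u u \<le> 0 \<Longrightarrow>
      (\<integral>\<^sup>+x. ennreal (\<bar>u x\<bar> powr p) \<partial>lborel) \<le> ennreal M"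
    using Lp_bounded_by_energy[OF order_refl] by blast
  have pos: "0 < Lp u" using ne Lp_nonneg[of u] by simp
  define c where "c = ((M + 1) / Lp u) powr (1 / p)"
  have "\<bar>c\<bar> powr p = (M + 1) / Lp u"
    using p pos M(1) by (simp add: c_def powr_powr)
  then have Lpc: "Lp (\<lambda>x. c * u x) = M + 1"
    using pos by (simp add: Lp_scale[OF u])
  have "ennreal (Lp (\<lambda>x. c * u x)) = (\<integral>\<^sup>+x. ennreal (\<bar>c * u x\<bar> powr p) \<partial>lborel)"
    unfolding Lp_def using Lp_integrable[OF H_scale[OF u]]
    by (intro nn_integral_eq_integral[symmetric]) auto
  also have "\<dots> \<le> ennreal M"
    by (intro M(2) H_scale[OF u]) (simp add: form_scale[OF u] zero)
  finally show False using M(1) by (simp add: Lpc)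
qed

section \<open>The Euler--Lagrange equation\<close>

text \<open>
  The right-hand side of the weak equation. All functions that it is applied to vanish outside \<open>\<Omega>\<close>.
\<close>

definition pairing :: "('a \<Rightarrow> real) \<Rightarrow> ('a \<Rightarrow> real) \<Rightarrow> real" where
  "pairing u \<phi> = (LINT x|lborel. \<bar>u x\<bar> powr (p - 2) * u x * \<phi> x)"

lemma pairing_integrable:
  assumes u: "u \<in> H" and \<phi>: "\<phi> \<in> H"
  shows "integrable lborel (\<lambda>x. \<bar>u x\<bar> powr (p - 2) * u x * \<phi> x)"
proof (rule Bochner_Integration.integrable_bound)
  note [measurable] = H_borel[OF u] H_borel[OF \<phi>]
  show "integrable lborel (\<lambda>x. \<bar>u x\<bar> powr p + \<bar>\<phi> x\<bar> powr p)"
    using Lp_integrable[OF u] Lp_integrable[OF \<phi>] by simp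
  show "(\<lambda>x. \<bar>u x\<bar> powr (p - 2) * u x * \<phi> x) \<in> borel_measurable lborel" by measurable
  show "AE x in lborel. norm (\<bar>u x\<bar> powr (p - 2) * u x * \<phi> x) \<le> norm (\<bar>u x\<bar> powr p + \<bar>\<phi> x\<bar> powr p)"
    using p abs_powr_mult_le[of p] by (intro AE_I2) (auto simp del: abs_mult)
qed

lemma Lp_tangent_le:
  assumes u: "u \<in> H" and \<phi>: "\<phi> \<in> H"
  shows "Lp u + p * \<epsilon> * pairing u \<phi> \<le> Lp (\<lambda>x. u x + \<epsilon> * \<phi> x)"
proof -
  have "Lp u + p * \<epsilon> * pairing u \<phi> =
      (LINT x|lborel. \<bar>u x\<bar> powr p + p * \<epsilon> * (\<bar>u x\<bar> powr (p - 2) * u x * \<phi> x))"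
    unfolding Lp_def pairing_def using Lp_integrable[OF u] pairing_integrable[OF u \<phi>] by simp
  also have "\<dots> \<le> Lp (\<lambda>x. u x + \<epsilon> * \<phi> x)"
    unfolding Lp_def
  proof (rule integral_mono)
    show "integrable lborel (\<lambda>x. \<bar>u x\<bar> powr p + p * \<epsilon> * (\<bar>u x\<bar> powr (p - 2) * u x * \<phi> x))"
      using Lp_integrable[OF u] pairing_integrable[OF u \<phi>] by simp
    show "integrable lborel (\<lambda>x. \<bar>u x + \<epsilon> * \<phi> x\<bar> powr p)"
      by (rule Lp_integrable[OF energy_space_add_scale[OF u \<phi>]])
    show "\<bar>u x\<bar> powr p + p * \<epsilon> * (\<bar>u x\<bar> powr (p - 2) * u x * \<phi> x) \<le> \<bar>u x + \<epsilon> * \<phi> x\<bar> powr p" for x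
      using powr_tangent_le[of p "u x" "\<epsilon> * \<phi> x"] p by (simp add: mult_ac)
  qed
  finally show ?thesis .
qed

text \<open>
  By \<open>Lp_tangent_le\<close>, replacing \<open>Lp (u + \<epsilon> * \<phi>)\<close> in the minimality of \<open>u\<close> by its linear lower bound
  leaves a function \<open>f\<close> of \<open>\<epsilon>\<close> that is explicit, nonnegative near \<open>0\<close> and zero at \<open>0\<close>. No
  differentiation under the integral is needed.
\<close>

lemma minimizer_Euler_Lagrange:
  assumes u: "u \<in> H" and Lp1: "Lp u = 1"
    and min: "\<And>v. v \<in> H \<Longrightarrow> form u u * Lp v powr (2 / p) \<le> form v v"
    and \<phi>: "\<phi> \<in> H"
  shows "form u \<phi> = form u u * pairing u \<phi>"
proof -
  let ?e = "form u u" and ?D = "pairing u \<phi>"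
  define f where "f \<epsilon> = ?e + 2 * \<epsilon> * form u \<phi> + \<epsilon>\<^sup>2 * form \<phi> \<phi> - ?e * (1 + p * \<epsilon> * ?D) powr (2 / p)" for \<epsilon>
  \<comment> \<open>for \<open>\<bar>\<epsilon>\<bar> < d\<close> the base of the power in \<open>f\<close> is positive\<close>
  define d where "d = 1 / (p * (\<bar>?D\<bar> + 1))"
  have d: "0 < d" using p by (simp add: d_def add_nonneg_pos)
  have nonneg: "0 \<le> f \<epsilon>" if \<epsilon>: "\<bar>\<epsilon>\<bar> < d" for \<epsilon>
  proof -
    have "\<bar>p * \<epsilon> * ?D\<bar> \<le> \<bar>\<epsilon>\<bar> * (p * (\<bar>?D\<bar> + 1))"
      using p by (simp add: abs_mult algebra_simps)
    also have "\<dots> < d * (p * (\<bar>?D\<bar> + 1))"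
      using \<epsilon> p by (intro mult_strict_right_mono) (auto intro!: mult_pos_pos add_nonneg_pos)
    also have "\<dots> = 1" using p by (simp add: d_def add_nonneg_eq_0_iff)
    finally have pos: "0 < 1 + p * \<epsilon> * ?D" by (simp add: abs_less_iff)
    have "?e * (1 + p * \<epsilon> * ?D) powr (2 / p) \<le> ?e * Lp (\<lambda>x. u x + \<epsilon> * \<phi> x) powr (2 / p)"
      using Lp_tangent_le[OF u \<phi>, of \<epsilon>] pos p
      by (intro mult_left_mono powr_mono2 form_self_nonneg) (auto simp: Lp1)
    also have "\<dots> \<le> form (\<lambda>x. u x + \<epsilon> * \<phi> x) (\<lambda>x. u x + \<epsilon> * \<phi> x)"
      by (rule min[OF energy_space_add_scale[OF u \<phi>]])
    finally show ?thesis by (simp add: f_def form_add_scale[OF u \<phi>])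
  qed
  have deriv: "(f has_real_derivative 2 * form u \<phi> - 2 * ?e * ?D) (at 0)"
    unfolding f_def[abs_def] using p
    by (auto intro!: derivative_eq_intros simp: field_simps)
  have "2 * form u \<phi> - 2 * ?e * ?D = 0"
    using nonneg by (intro DERIV_local_min[OF deriv d]) (auto simp: f_def)
  then show ?thesis by simp
qed

text \<open>
  The Lagrange multiplier \<open>form u u\<close> is removed by scaling, since the two sides of the equation have degrees \<open>1\<close> and \<open>p - 1 > 1\<close>.
\<close>

lemma ex_solution:
  "\<exists>u\<in>H. Lp u \<noteq> 0 \<and> (\<forall>\<phi>\<in>H. form u \<phi> = pairing u \<phi>)"
proof -
  obtain u where u: "u \<in> H" "Lp u = 1" "\<And>v. v \<in> H \<Longrightarrow> form u u * Lp v powr (2 / p) \<le> form v v"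
    using ex_minimizer by blast
  define c where "c = form u u powr (1 / (p - 2))"
  have e: "0 < form u u" using form_pos[OF u(1)] u(2) by simp
  have c: "0 < c" "c powr (p - 2) = form u u" using e p by (auto simp: c_def powr_powr)
  have "form (\<lambda>x. c * u x) \<phi> = pairing (\<lambda>x. c * u x) \<phi>" if \<phi>: "\<phi> \<in> H" for \<phi>
  proof -
    have "pairing (\<lambda>x. c * u x) \<phi> = (LINT x|lborel. (c powr (p - 2) * c) * (\<bar>u x\<bar> powr (p - 2) * u x * \<phi> x))"
      unfolding pairing_def using c(1) by (simp add: abs_mult powr_mult mult_ac)
    also have "\<dots> = c powr (p - 2) * c * pairing u \<phi>" by (simp add: pairing_def)
    also have "\<dots> = c * form u \<phi>"
      using minimizer_Euler_Lagrange[OF u \<phi>] by (simp add: c(2))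
    finally show ?thesis by (simp add: form_scale_left[OF u(1)])
  qed
  moreover have "Lp (\<lambda>x. c * u x) \<noteq> 0" using c(1) by (simp add: Lp_scale[OF u(1)] u(2))
  ultimately show ?thesis using H_scale[OF u(1)] by (intro bexI[of _ "\<lambda>x. c * u x"]) auto
qed

end

section \<open>From Borel functions to Lebesgue measurable classes\<close>

lemma
  fixes f g :: "'a::euclidean_space \<Rightarrow> real"
  assumes g: "g \<in> borel_measurable borel" and eq: "AE x in lborel. f x = g x"
  shows integrable_lebesgue_AE_borel: "integrable lebesgue f \<longleftrightarrow> integrable lborel g"
    and integral_lebesgue_AE_borel: "(LINT x|lebesgue. f x) = (LINT x|lborel. g x)"
proof -
  have g': "g \<in> borel_measurable lebesgue" using g by (intro measurable_completion) simp
  have eq': "AE x in lebesgue. f x = g x" using eq by (rule AE_completion)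
  then have f: "f \<in> borel_measurable lebesgue"
    by (intro borel_measurable_AE[OF g']) (auto elim: eventually_mono)
  have "integrable lebesgue f \<longleftrightarrow> integrable lebesgue g"
    by (rule integrable_cong_AE[OF f g' eq'])
  then show "integrable lebesgue f \<longleftrightarrow> integrable lborel g"
    using g by (simp add: integrable_completion)
  have "(LINT x|lebesgue. f x) = (LINT x|lebesgue. g x)"
    by (rule integral_cong_AE[OF f g' eq'])
  then show "(LINT x|lebesgue. f x) = (LINT x|lborel. g x)"
    using g by (simp add: integral_completion)
qed

lemma radially_decreasing_borel:
  fixes K :: "'a::euclidean_space \<Rightarrow> real"
  assumes decr: "\<And>x y. x \<noteq> 0 \<Longrightarrow> y \<noteq> 0 \<Longrightarrow> norm x \<le> norm y \<Longrightarrow> K y \<le> K x"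
  shows "(\<lambda>x. if x = 0 then 0 else K x) \<in> borel_measurable borel"
proof -
  obtain e :: 'a where e: "norm e = 1" using norm_Basis nonempty_Basis by blast
  define k where "k r = - K (r *\<^sub>R e)" for r
  have "mono_on {0<..} k"
  proof (rule mono_onI)
    fix r t :: real assume "r \<in> {0<..}" "t \<in> {0<..}" "r \<le> t"
    with e have "K (t *\<^sub>R e) \<le> K (r *\<^sub>R e)" by (intro decr) auto
    then show "k r \<le> k t" by (simp add: k_def)
  qed
  then have "k \<in> borel_measurable (restrict_space borel {0<..})"
    by (rule borel_measurable_mono_on_fnc)
  then have k: "(\<lambda>r. indicator {0<..} r *\<^sub>R k r) \<in> borel_measurable borel"
    by (subst (asm) borel_measurable_restrict_space_iff) auto
  have "(if x = 0 then 0 else K x) = - (indicator {0<..} (norm x) *\<^sub>R k (norm x))" for x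
  proof (cases "x = 0")
    case False
    moreover have "e \<noteq> 0" using e by auto
    ultimately have "K x = K (norm x *\<^sub>R e)" using e by (intro antisym decr) auto
    with False show ?thesis by (simp add: k_def)
  qed simp
  moreover have "(\<lambda>x::'a. indicator {0<..} (norm x) *\<^sub>R k (norm x)) \<in> borel_measurable borel"
    by (rule measurable_compose[OF _ k]) measurable
  ultimately show ?thesis by (simp only: borel_measurable_uminus)
qed

context subcritical
begin

text \<open>
  Every test function has a Borel representative in \<open>energy_space \<Omega>\<close>. The kernels \<open>K'\<close> and \<open>K\<close> may differ
  at the origin.
\<close>

lemma X0_space_borel_version:
  assumes KK: "\<And>x. x \<noteq> 0 \<Longrightarrow> K' x = K x" and \<phi>: "\<phi> \<in> X0_space K' \<Omega>"
  obtains \<psi> where "\<psi> \<in> H" "AE x in lborel. \<phi> x = \<psi> x"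
proof -
  let ?S = "- ((- \<Omega>) \<times> (- \<Omega>)) :: ('a \<times> 'a) set"
  have X: "\<phi> \<in> borel_measurable lebesgue"
    "set_integrable lebesgue ?S (\<lambda>(x, y). (\<phi> x - \<phi> y)\<^sup>2 * K' (x - y))"
    and off: "AE x in lborel. x \<notin> \<Omega> \<longrightarrow> \<phi> x = 0"
    using \<phi> by (auto simp: X0_space_def X_space_def AE_completion_iff)
  obtain g where g [measurable]: "g \<in> borel_measurable borel" and g_eq: "AE x in lborel. \<phi> x = g x"
    using completion_ex_borel_measurable_real[OF X(1)] by auto
  define \<psi> where "\<psi> x = indicator \<Omega> x * g x" for x
  have \<psi> [measurable]: "\<psi> \<in> borel_measurable borel" unfolding \<psi>_def[abs_def] by measurable
  have eq: "AE x in lborel. \<phi> x = \<psi> x"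
    using g_eq off by eventually_elim (auto simp: \<psi>_def split: split_indicator)
  have density_eq: "AE z in lborel. indicator ?S z *\<^sub>R (case z of (x, y) \<Rightarrow> (\<phi> x - \<phi> y)\<^sup>2 * K' (x - y)) = energy_density \<psi> \<psi> z"
    using AE_lborel_pair[OF eq]
  proof eventually_elim
    case (elim z)
    then show ?case
      using KK[of "fst z - snd z"]
      by (cases "fst z = snd z")
         (auto simp: energy_density_def \<psi>_def power2_eq_square case_prod_beta mem_Times_iff split: split_indicator)
  qed
  have "integrable lborel (energy_density \<psi> \<psi>)"
    using integrable_lebesgue_AE_borel[OF energy_density_borel[OF \<psi> \<psi>] density_eq] X(2) by (simp add: set_integrable_def)
  then have "\<psi> \<in> H" using \<psi> by (simp add: energy_space_def \<psi>_def)
  with eq that show thesis by blast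
qed

lemma weak_solutionI:
  assumes KK: "\<And>x. x \<noteq> 0 \<Longrightarrow> K' x = K x" and u: "u \<in> H"
    and sol: "\<And>\<phi>. \<phi> \<in> H \<Longrightarrow> form u \<phi> = pairing u \<phi>"
  shows "weak_solution K' \<Omega> (\<lambda>x t. \<bar>t\<bar> powr (p - 2) * t) u"
  unfolding weak_solution_def
proof (intro conjI ballI)
  note ub [measurable] = H_borel[OF u]
  let ?S = "- ((- \<Omega>) \<times> (- \<Omega>)) :: ('a \<times> 'a) set"
  have density_KK: "energy_density f g z = (f (fst z) - f (snd z)) * (g (fst z) - g (snd z)) * K' (fst z - snd z)" for f g z
    using KK[of "fst z - snd z"] by (cases "fst z = snd z") (auto simp: energy_density_def)
  have "closed ((- \<Omega>) \<times> (- \<Omega>))"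
    using open_\<Omega> by (intro closed_Times) (auto simp: closed_open)
  then have S: "?S \<in> sets lebesgue"
    by (intro sets_completionI_sets) auto
  show "u \<in> X0_space K' \<Omega>"
    unfolding X0_space_def X_space_def
  proof (intro CollectI conjI)
    show "u \<in> borel_measurable lebesgue" using ub by (intro measurable_completion) simp
    have "integrable lebesgue (\<lambda>x. (u x)\<^sup>2)"
      using H_L2[OF u] by (subst integrable_completion) auto
    then show "set_integrable lebesgue \<Omega> (\<lambda>x. (u x)\<^sup>2)"
      unfolding set_integrable_def by (rule integrable_mult_indicator[rotated]) auto
    have "(\<lambda>(x, y). (u x - u y)\<^sup>2 * K' (x - y)) = energy_density u u"
      by (rule ext) (simp add: density_KK case_prod_beta power2_eq_square)
    moreover have "integrable lebesgue (energy_density u u)"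
      using energy_spaceD(3)[OF u] by (subst integrable_completion) auto
    from integrable_mult_indicator[OF S this]
    have "set_integrable lebesgue ?S (energy_density u u)" by (simp add: set_integrable_def)
    ultimately show "set_integrable lebesgue ?S (\<lambda>(x, y). (u x - u y)\<^sup>2 * K' (x - y))"
      by simp
    show "AE x in lebesgue. x \<in> - \<Omega> \<longrightarrow> u x = 0"
      using energy_spaceD(2)[OF u] by auto
  qed
  fix \<phi> assume "\<phi> \<in> X0_space K' \<Omega>"
  then obtain \<psi> where \<psi>: "\<psi> \<in> H" and eq: "AE x in lborel. \<phi> x = \<psi> x"
    using X0_space_borel_version[OF KK] by blast
  note \<psi>b [measurable] = H_borel[OF \<psi>]
  have eq1: "AE z in lborel. (case z of (x, y) \<Rightarrow> (u x - u y) * (\<phi> x - \<phi> y) * K' (x - y)) = energy_density u \<psi> z"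
    using AE_lborel_pair[OF eq] by eventually_elim (simp add: density_KK case_prod_beta)
  have eq2: "AE x in lborel. indicator \<Omega> x *\<^sub>R (\<bar>u x\<bar> powr (p - 2) * u x * \<phi> x) = \<bar>u x\<bar> powr (p - 2) * u x * \<psi> x"
    using eq
  proof eventually_elim
    case (elim x)
    then show ?case using energy_spaceD(2)[OF u, of x] by (cases "x \<in> \<Omega>") auto
  qed
  have meas: "(\<lambda>x. \<bar>u x\<bar> powr (p - 2) * u x * \<psi> x) \<in> borel_measurable borel" by measurable
  show "integrable lebesgue (\<lambda>(x, y). (u x - u y) * (\<phi> x - \<phi> y) * K' (x - y))"
    using energy_density_integrable[OF u \<psi>] integrable_lebesgue_AE_borel[OF energy_density_borel[OF ub \<psi>b] eq1] by simp
  show "set_integrable lebesgue \<Omega> (\<lambda>x. \<bar>u x\<bar> powr (p - 2) * u x * \<phi> x)"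
    unfolding set_integrable_def
    using pairing_integrable[OF u \<psi>] integrable_lebesgue_AE_borel[OF meas eq2] by simp
  show "(LINT (x, y)|lebesgue. (u x - u y) * (\<phi> x - \<phi> y) * K' (x - y)) =
      (LINT x:\<Omega>|lebesgue. \<bar>u x\<bar> powr (p - 2) * u x * \<phi> x)"
    using sol[OF \<psi>] integral_lebesgue_AE_borel[OF energy_density_borel[OF ub \<psi>b] eq1]
      integral_lebesgue_AE_borel[OF meas eq2]
    by (simp add: set_lebesgue_integral_def form_def pairing_def)
qed

end

text \<open>
  The condition on \<open>p\<close> says that \<open>sp < s0\<close>, where \<open>p\<close> is exactly critical for the order \<open>sp\<close>; this
  covers the limiting case \<open>N = 2\<close>, \<open>s0 = 1\<close> as well. An order strictly below \<open>s0\<close> also has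
  \<open>2 * s < N\<close>.
\<close>

lemma ex_subcritical_order:
  fixes p s0 :: real
  assumes N: "2 \<le> N" and s0: "0 < s0" "s0 \<le> 1" and p: "2 < p" "ereal p < critical_exponent N s0"
  obtains s where "0 < s" "s < s0" "2 * s < real N" "p < 2 / (1 - 2 * s / real N)"
proof -
  define sp where "sp = real N * (1 / 2 - 1 / p)"
  have sp: "0 < sp" using N p by (simp add: sp_def field_simps)
  have "sp < s0"
  proof (cases "N = 2 \<and> s0 = 1")
    case True
    then show ?thesis using p by (simp add: sp_def)
  next
    case False
    then have pos: "0 < real N - 2 * s0" using N s0 by auto
    have "p < 2 * real N / (real N - 2 * s0)"
      using p False unfolding critical_exponent_def if_not_P[OF False] by simp
    then have "p * (real N - 2 * s0) < 2 * real N" using pos by (simp add: pos_less_divide_eq)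
    then show ?thesis using p by (simp add: sp_def field_simps)
  qed
  define s where "s = (sp + s0) / 2"
  have s: "sp < s" "s < s0" using \<open>sp < s0\<close> by (auto simp: s_def)
  have N2: "2 * s < real N" using s s0 N by linarith
  have "1 - 2 * s / real N < 2 / p" using s(1) N p by (simp add: sp_def field_simps)
  moreover have "0 < 1 - 2 * s / real N" using N2 N by (simp add: field_simps)
  ultimately have "p < 2 / (1 - 2 * s / real N)" using p by (simp add: field_simps)
  with s sp N2 show thesis by (intro that) auto
qed

text \<open>
  The set whose supremum is the order of the kernel is closed downwards among nonnegative numbers.
\<close>

lemma tail_limit_below_kernel_order:
  fixes K :: "'a::euclidean_space \<Rightarrow> real"
  assumes s: "0 \<le> s" "ereal s < kernel_order K" and K: "\<And>x. x \<noteq> 0 \<Longrightarrow> 0 \<le> K x"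
  shows "filterlim (\<lambda>r. r powr (2 * s) * (LINT y:- ball 0 r|lebesgue. K y)) at_top (at_right 0)"
proof -
  obtain s1 where s1: "s < s1"
    "filterlim (\<lambda>r. r powr (2 * s1) * (LINT y:- ball 0 r|lebesgue. K y)) at_top (at_right 0)"
    using s(2) unfolding kernel_order_def less_Sup_iff by auto
  have "eventually (\<lambda>r. r powr (2 * s1) * (LINT y:- ball 0 r|lebesgue. K y)
      \<le> r powr (2 * s) * (LINT y:- ball 0 r|lebesgue. K y)) (at_right 0)"
    unfolding eventually_at_right_field
  proof (intro exI[of _ 1] conjI allI impI)
    fix r :: real assume r: "0 < r" "r < 1"
    have "0 \<le> (LINT y:- ball 0 r|lebesgue. K y)"
      unfolding set_lebesgue_integral_def
    proof (rule Bochner_Integration.integral_nonneg)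
      fix y show "0 \<le> indicator (- ball 0 r) y *\<^sub>R K y"
        using r K[of y] by (cases "y = 0") (auto split: split_indicator)
    qed
    moreover have "r powr (2 * s1) \<le> r powr (2 * s)" using r s1 by (intro powr_mono') auto
    ultimately show "r powr (2 * s1) * (LINT y:- ball 0 r|lebesgue. K y)
      \<le> r powr (2 * s) * (LINT y:- ball 0 r|lebesgue. K y)" by (intro mult_right_mono)
  qed simp
  with s1(2) show ?thesis by (rule filterlim_at_top_mono)
qed

theorem theorem1p2:
  fixes K :: "real ^ 'n \<Rightarrow> real" and \<Omega> :: "(real ^ 'n) set" and s0 p :: real
  assumes "CARD('n) \<ge> 2"
    and "bounded_C2_domain \<Omega>"
    and "K \<in> borel_measurable lebesgue"
    and "\<And>x. x \<noteq> 0 \<Longrightarrow> K x > 0"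
    and "integrable lebesgue (\<lambda>x. min ((norm x)\<^sup>2) 1 * K x)"
    and "\<And>x. x \<noteq> 0 \<Longrightarrow> K x = K (- x)"
    and "\<And>x y. x \<noteq> 0 \<Longrightarrow> y \<noteq> 0 \<Longrightarrow> norm x \<le> norm y \<Longrightarrow> K x \<ge> K y"
    and "ereal s0 = kernel_order K"
    and "0 < s0" and "s0 \<le> 1"
    and "2 < p" and "ereal p < critical_exponent CARD('n) s0"
  shows "\<exists>u. weak_solution K \<Omega> (\<lambda>x t. \<bar>t\<bar> powr (p - 2) * t) u \<and>
             \<not> (AE x in lebesgue. u x = 0)"
proof -
  \<comment> \<open>\<open>K0\<close> meets the normalisation of the kernel at the origin\<close>
  define K0 where "K0 x = (if x = 0 then 0 else K x)" for x
  have K0_borel [measurable]: "K0 \<in> borel_measurable borel"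
    unfolding K0_def[abs_def] by (rule radially_decreasing_borel) fact
  obtain s where s: "0 < s" "s < s0" "2 * s < real CARD('n)" "p < 2 / (1 - 2 * s / real CARD('n))"
    using ex_subcritical_order[of "CARD('n)" s0 p] assms by blast
  interpret radial_kernel K0
  proof
    have "(\<lambda>x. min ((norm x)\<^sup>2) 1 * K0 x) = (\<lambda>x. min ((norm x)\<^sup>2) 1 * K x)"
      by (auto simp: K0_def)
    moreover have "(\<lambda>x. min ((norm x)\<^sup>2) 1 * K0 x) \<in> borel_measurable lborel" by measurable
    ultimately show "integrable lborel (\<lambda>x. min ((norm x)\<^sup>2) 1 * K0 x)"
      using assms(5) integrable_completion[of "\<lambda>x. min ((norm x)\<^sup>2) 1 * K0 x" lborel] by simp
    show "0 < K0 x" if "x \<noteq> 0" for x using that assms(4) by (simp add: K0_def)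
    show "K0 y \<le> K0 x" if "x \<noteq> 0" "y \<noteq> 0" "norm x \<le> norm y" for x y
      using that assms(7) by (simp add: K0_def)
  qed (auto simp: K0_def)
  have tail_eq: "(LINT y:- ball 0 r|lebesgue. K y) = tail r" if "0 < r" for r
    unfolding tail_def set_lebesgue_integral_def
  proof (rule integral_lebesgue_AE_borel)
    show "(\<lambda>x. indicator (- ball 0 r) x *\<^sub>R K0 x) \<in> borel_measurable borel" by measurable
    show "AE x in lborel. indicator (- ball 0 r) x *\<^sub>R K x = indicator (- ball 0 r) x *\<^sub>R K0 x"
      using that by (auto simp: K0_def)
  qed
  have lim: "filterlim (\<lambda>r. r powr (2 * s) * (LINT y:- ball 0 r|lebesgue. K y)) at_top (at_right 0)"
    using s(1,2) assms(4) by (intro tail_limit_below_kernel_order) (auto simp: less_imp_le simp flip: assms(8))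
  have "filterlim (\<lambda>r. r powr (2 * s) * tail r) at_top (at_right 0)"
    by (rule filterlim_mono_eventually[OF lim order_refl order_refl])
       (use tail_eq in \<open>auto simp: eventually_at_right_field intro!: exI[of _ 1]\<close>)
  then interpret subcritical K0 \<Omega> s p
    using assms(2,11) s by unfold_locales (auto simp: bounded_C2_domain_def)
  obtain u where u: "u \<in> H" "Lp u \<noteq> 0" "\<And>\<phi>. \<phi> \<in> H \<Longrightarrow> form u \<phi> = pairing u \<phi>"
    using ex_solution by blast
  have "weak_solution K \<Omega> (\<lambda>x t. \<bar>t\<bar> powr (p - 2) * t) u"
    using u by (intro weak_solutionI) (auto simp: K0_def)
  moreover have "\<not> (AE x in lebesgue. u x = 0)"
  proof
    assume "AE x in lebesgue. u x = 0"
    then have "AE x in lborel. u x = 0" by (simp add: AE_completion_iff)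
    then have "Lp u = 0"
      unfolding Lp_def by (intro integral_eq_zero_AE) (auto elim: eventually_mono)
    with u(2) show False by simp
  qed
  ultimately show ?thesis by blast
qed

end
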